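(* Let $a>0$, $b,c\in\mathbb R$, and let $C$ be the parabola $y=\tfrac a2x^2+bx+c$, with grid peeling with respect to $\mathbb Z^2$. Let $t\ge1$ be an integer, with the convention $1/H_0=+\infty$. (1) If $\frac1{H_t}<a<\frac1{H_{t-1}}$ and $t$ is odd, then $v_-(C)=v_+(C)=1/t$. (For $t=1$ this says: if $a>1$ then $v_-(C)=v_+(C)=1$.) (2) If $\frac1{H_t}<a<\frac1{H_{t-1}}$ and $t$ is even, then $\frac1{t+1}\le v_-(C)\le v_+(C)\le\frac1{t-1}$. (3) If $a=\frac1{H_t}$ and $t$ is odd, then $\frac1{t+2}\le v_-(C)\le v_+(C)\le\frac1t$. (4) If $a=\frac1{H_t}$ and $t$ is even, then $\frac1{t+1}\le v_-(C)\le v_+(C)\le\frac1{t-1}$.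
   Context: $H_t=\sum_{1\le y\le x\le t,\ \gcd(x,y)=1}\lfloor t/x\rfloor\,x$ (so $H_1=1,H_2=4,H_3=11,\dots$). Grid peeling: one step $f$ applied to a set $U$ removes all vertices (extreme points) of $\mathrm{conv}(U)$. For $C$ the graph of a convex function on $\mathbb R$, $f^{(m)}(C)$ denotes the lower boundary of $\mathrm{conv}(f^m(U_0))$, where $U_0$ is the set of points of $\mathbb Z^2$ on or above $C$. $C+\gamma$ denotes the vertical translate of $C$ by $\gamma$; for two such curves, $C\le D$ means no point of $C$ lies above $D$. Lower and upper average speeds: $v_-(C)=\liminf_{m\to\infty}\frac1m\sup\{\gamma: C+\gamma\le f^{(m)}(C)\}$ and $v_+(C)=\limsup_{m\to\infty}\frac1m\inf\{\gamma: f^{(m)}(C)\le C+\gamma\}$. *)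

theory Defs
  imports "HOL-Analysis.Analysis"
begin

definition H :: "nat \<Rightarrow> nat" where
  "H t = (\<Sum>(x, y) \<in> {(x, y). 1 \<le> y \<and> y \<le> x \<and> x \<le> t \<and> gcd x y = 1}. (t div x) * x)"

definition U0 :: "(real \<Rightarrow> real) \<Rightarrow> (real \<times> real) set" where
  "U0 g = {p. fst p \<in> \<int> \<and> snd p \<in> \<int> \<and> snd p \<ge> g (fst p)}"

definition peel :: "(real \<times> real) set \<Rightarrow> (real \<times> real) set" where
  "peel U = U - {p. p extreme_point_of (convex hull U)}"

definition lb_dom :: "(real \<times> real) set \<Rightarrow> real set" where
  "lb_dom S = {x. \<exists>y. (x, y) \<in> S}"

definition lb :: "(real \<times> real) set \<Rightarrow> real \<Rightarrow> real" where
  "lb S x = Inf {y. (x, y) \<in> S}"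

definition peeled_hull :: "(real \<Rightarrow> real) \<Rightarrow> nat \<Rightarrow> (real \<times> real) set" where
  "peeled_hull g m = convex hull ((peel ^^ m) (U0 g))"

definition below_peeled :: "(real \<Rightarrow> real) \<Rightarrow> nat \<Rightarrow> real \<Rightarrow> bool" where
  "below_peeled g m \<gamma> \<longleftrightarrow>
     (\<forall>x \<in> lb_dom (peeled_hull g m). g x + \<gamma> \<le> lb (peeled_hull g m) x)"

definition above_peeled :: "(real \<Rightarrow> real) \<Rightarrow> nat \<Rightarrow> real \<Rightarrow> bool" where
  "above_peeled g m \<gamma> \<longleftrightarrow>
     (\<forall>x \<in> lb_dom (peeled_hull g m). lb (peeled_hull g m) x \<le> g x + \<gamma>)"

definition v_minus :: "(real \<Rightarrow> real) \<Rightarrow> ereal" where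
  "v_minus g = liminf (\<lambda>m. Sup (ereal ` {\<gamma>. below_peeled g m \<gamma>}) / ereal (real m))"

definition v_plus :: "(real \<Rightarrow> real) \<Rightarrow> ereal" where
  "v_plus g = limsup (\<lambda>m. Inf (ereal ` {\<gamma>. above_peeled g m \<gamma>}) / ereal (real m))"

end

theory Submission
  imports Defs
begin

text \<open>
  For every \<open>T \<ge> 1\<close>, regardless of its parity, there are lattice fronts that move up by exactly one unit
  in \<open>T\<close> peeling steps. Run through the fractions \<open>q/p\<close> with denominator at most \<open>n\<close> in increasing
  order, where \<open>n = T\<close> or \<open>n = T - 1\<close>, and attach to each gap between consecutive fractions a vertical strip
  of \<open>T\<close> columns, shifting the strip by \<open>p * (n div p)\<close> columns whenever \<open>q/p\<close> is passed. Inside a strip the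
  lattice points are removed one at a time, in the order in which a line whose slope lies in the gap
  sweeps over them. Overlapping strips prescribe the same removal times, and the removal time of a point is
  the minimum over all strips of its rank in the order of the strip.

  Hence every point is a vertex when its time comes, as the sweep line exposes it, and so the front moves with
  speed at least \<open>1/T\<close>. If \<open>n = T - 1\<close>, then every point is the midpoint of two lattice points that are
  removed at most one step earlier, so the speed is at most \<open>1/T\<close>. As the slope
  increases by 1, the strips advance by \<open>H n\<close> columns, so that the front stays within bounded distance of a
  parabola with second derivative \<open>1 / H n\<close>. Peeling is monotone, and a parabola that is strictly more
  (less) curved can be touched at every point, up to a bounded error, from below (above) by an integer
  shear of this front.
\<close>

subsection \<open>Fronts that move up by one level per peeling step\<close>

text \<open>In these definitions \<open>T * y + G x\<close> is the peeling step in which the lattice point \<open>(x, y)\<close> disappears.\<close>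

definition wave :: "int \<Rightarrow> (int \<Rightarrow> int) \<Rightarrow> int \<Rightarrow> (real \<times> real) set" where
  "wave T G M = {(of_int x, of_int y) | x y. M \<le> T * y + G x}"

definition exposed :: "int \<Rightarrow> (int \<Rightarrow> int) \<Rightarrow> bool" where
  "exposed T G \<longleftrightarrow> (\<forall>x. \<exists>\<sigma>::real. \<forall>x' y.
     G x \<le> T * y + G x' \<and> (x' \<noteq> x \<or> y \<noteq> 0) \<longrightarrow> \<sigma> * of_int (x' - x) < of_int y)"

definition bridged :: "int \<Rightarrow> (int \<Rightarrow> int) \<Rightarrow> bool" where
  "bridged T G \<longleftrightarrow> (\<forall>x. \<exists>p q. (p, q) \<noteq> (0, 0) \<and>
     G x - 1 \<le> T * q + G (x + p) \<and> G x - 1 \<le> G (x - p) - T * q)"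

lemma wave_iff: "(of_int x, of_int y) \<in> wave T G M \<longleftrightarrow> M \<le> T * y + G x"
  by (auto simp: wave_def)

lemma peel_mono: "U \<subseteq> V \<Longrightarrow> peel U \<subseteq> peel V"
  using hull_mono[of U V convex] hull_inc[of _ U convex]
  by (fastforce simp: peel_def extreme_point_of_def)

lemma peel_funpow_mono: "U \<subseteq> V \<Longrightarrow> (peel ^^ m) U \<subseteq> (peel ^^ m) V"
  by (induction m) (auto dest: peel_mono)

text \<open>Adding \<open>z\<close> to the open half-space \<open>f z < f w\<close> gives a convex
  set that contains \<open>U\<close>, hence the hull, and in which no open segment passes through
  \<open>z\<close>.\<close>

lemma unique_minimiser_extreme_point:
  fixes U :: "'a::real_vector set" and f :: "'a \<Rightarrow> real"
  assumes f: "linear f" and z: "z \<in> U" and min: "\<And>w. w \<in> U \<Longrightarrow> w \<noteq> z \<Longrightarrow> f z < f w"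
  shows "z extreme_point_of (convex hull U)"
proof -
  have *: "f z < f (u *\<^sub>R v + w *\<^sub>R v')"
    if "v = z \<or> f z < f v" "v' = z \<or> f z < f v'" "0 < u" "0 < w" "u + w = 1" "\<not> (v = z \<and> v' = z)" for u v w v'
  proof -
    have "u * f z + w * f z < u * f v + w * f v'"
      using that by (auto intro: add_le_less_mono add_less_le_mono)
    then show ?thesis
      using that(5) by (simp add: linear_add[OF f] linear_scale[OF f] flip: distrib_right)
  qed
  have "convex (insert z {w. f z < f w})"
  proof (rule convexI)
    fix v v' and u w :: real
    assume "v \<in> insert z {w. f z < f w}" "v' \<in> insert z {w. f z < f w}" "0 \<le> u" "0 \<le> w" "u + w = 1"
    then show "u *\<^sub>R v + w *\<^sub>R v' \<in> insert z {w. f z < f w}"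
      using *[of v v' u w] by (cases "u = 0"; cases "w = 0"; cases "v = z \<and> v' = z") (auto simp flip: scaleR_add_left)
  qed
  then have sub: "convex hull U \<subseteq> insert z {w. f z < f w}"
    using min by (intro hull_minimal) auto
  show ?thesis
    unfolding extreme_point_of_def
  proof (intro conjI ballI notI)
    show "z \<in> convex hull U" using z by (rule hull_inc)
    fix v v' assume v: "v \<in> convex hull U" "v' \<in> convex hull U" and "z \<in> open_segment v v'"
    then obtain u where u: "0 < u" "u < 1" "z = (1 - u) *\<^sub>R v + u *\<^sub>R v'" "v \<noteq> v'"
      by (auto simp: in_segment)
    then have "f z < f ((1 - u) *\<^sub>R v + u *\<^sub>R v')"
      using v sub by (intro *) auto
    then show False using u by simp
  qed
qed

text \<open>A point with removal time exactly \<open>M\<close> is the unique minimiser of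
  \<open>y - \<sigma> * x\<close> on the wave, hence a vertex. Vertical translation shifts all times
  equally, so testing at height 0 suffices.\<close>

lemma peel_wave_subset:
  assumes "exposed T G"
  shows "peel (wave T G M) \<subseteq> wave T G (M + 1)"
proof
  fix z assume z: "z \<in> peel (wave T G M)"
  then obtain x y where xy: "z = (of_int x, of_int y)" and M: "M \<le> T * y + G x"
    by (auto simp: peel_def wave_def)
  show "z \<in> wave T G (M + 1)"
  proof (rule ccontr)
    assume "z \<notin> wave T G (M + 1)"
    then have eq: "T * y + G x = M" using xy M by (auto simp: wave_def)
    obtain \<sigma> :: real where \<sigma>: "\<And>x' y. G x \<le> T * y + G x' \<Longrightarrow> x' \<noteq> x \<or> y \<noteq> 0 \<Longrightarrow> \<sigma> * of_int (x' - x) < of_int y"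
      using assms unfolding exposed_def by metis
    have lin: "linear (\<lambda>w. snd w - \<sigma> * fst w)"
      by (rule linearI) (auto simp: algebra_simps)
    have "z extreme_point_of (convex hull (wave T G M))"
    proof (rule unique_minimiser_extreme_point[OF lin])
      show "z \<in> wave T G M" using xy M by (simp add: wave_iff)
      fix w assume "w \<in> wave T G M" "w \<noteq> z"
      then obtain x' y' where w: "w = (of_int x', of_int y')" and "M \<le> T * y' + G x'" and "x' \<noteq> x \<or> y' \<noteq> y"
        using xy by (auto simp: wave_def)
      then have "\<sigma> * of_int (x' - x) < of_int (y' - y)"
        using eq by (intro \<sigma>) (auto simp: algebra_simps)
      then show "snd z - \<sigma> * fst z < snd w - \<sigma> * fst w"
        by (simp add: w xy algebra_simps)
    qed
    then show False using z by (simp add: peel_def)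
  qed
qed

text \<open>A point of time at least \<open>M + 1\<close> is the midpoint of two distinct points of
  time at least \<open>M\<close>, so it is no vertex.\<close>

lemma wave_subset_peel:
  assumes "bridged T G"
  shows "wave T G (M + 1) \<subseteq> peel (wave T G M)"
proof
  fix z assume "z \<in> wave T G (M + 1)"
  then obtain x y where xy: "z = (of_int x, of_int y)" and M: "M + 1 \<le> T * y + G x"
    by (auto simp: wave_def)
  obtain p q where pq: "(p, q) \<noteq> (0, 0)" "G x - 1 \<le> T * q + G (x + p)" "G x - 1 \<le> G (x - p) - T * q"
    using assms unfolding bridged_def by metis
  let ?u = "(of_int (x + p), of_int (y + q)) :: real \<times> real" and ?v = "(of_int (x - p), of_int (y - q)) :: real \<times> real"
  have "?u \<in> convex hull (wave T G M)" "?v \<in> convex hull (wave T G M)"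
    using pq M by (auto simp: wave_iff algebra_simps simp del: of_int_add of_int_diff intro!: hull_inc)
  moreover have "z \<in> open_segment ?u ?v"
  proof -
    have "z = midpoint ?u ?v" by (simp add: xy midpoint_def)
    moreover have "?u \<noteq> ?v" using pq(1) by (cases "p = 0") auto
    ultimately show ?thesis by (metis midpoint_in_open_segment)
  qed
  ultimately have "\<not> z extreme_point_of (convex hull (wave T G M))"
    unfolding extreme_point_of_def by blast
  then show "z \<in> peel (wave T G M)"
    using xy M by (simp add: peel_def wave_iff)
qed

lemma peel_funpow_wave_subset: "exposed T G \<Longrightarrow> (peel ^^ m) (wave T G M) \<subseteq> wave T G (M + int m)"
proof (induction m)
  case (Suc m)
  then show ?case
    using peel_mono[OF Suc.IH] peel_wave_subset[of T G "M + int m"] by (auto simp: ac_simps)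
qed simp

lemma wave_subset_peel_funpow: "bridged T G \<Longrightarrow> wave T G (M + int m) \<subseteq> (peel ^^ m) (wave T G M)"
proof (induction m)
  case (Suc m)
  then show ?case
    using peel_mono[OF Suc.IH] wave_subset_peel[of T G "M + int m"] by (auto simp: ac_simps)
qed simp

text \<open>The new front is the image under the lattice automorphism
  \<open>(x, y) \<mapsto> (x, y + s * x)\<close>, which adds \<open>s\<close> to the slope of every
  supporting line.\<close>

lemma exposed_shear: "exposed T G \<Longrightarrow> exposed T (\<lambda>x. G x - T * s * x)"
  unfolding exposed_def
proof
  fix x assume "\<forall>x. \<exists>\<sigma>::real. \<forall>x' y.
     G x \<le> T * y + G x' \<and> (x' \<noteq> x \<or> y \<noteq> 0) \<longrightarrow> \<sigma> * of_int (x' - x) < of_int y"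
  then obtain \<sigma> :: real where \<sigma>: "\<And>x' y. G x \<le> T * y + G x' \<Longrightarrow> x' \<noteq> x \<or> y \<noteq> 0 \<Longrightarrow> \<sigma> * of_int (x' - x) < of_int y"
    by metis
  have "(\<sigma> + of_int s) * of_int (x' - x) < of_int y"
    if "G x - T * s * x \<le> T * y + (G x' - T * s * x')" "x' \<noteq> x \<or> y \<noteq> 0" for x' y
  proof -
    have "\<sigma> * of_int (x' - x) < of_int (y - s * (x' - x))"
      using that by (intro \<sigma>) (auto simp: algebra_simps)
    then show ?thesis by (simp add: algebra_simps)
  qed
  then show "\<exists>\<sigma>::real. \<forall>x' y. G x - T * s * x \<le> T * y + (G x' - T * s * x') \<and> (x' \<noteq> x \<or> y \<noteq> 0) \<longrightarrow>
      \<sigma> * of_int (x' - x) < of_int y"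
    by blast
qed

lemma bridged_shear: "bridged T G \<Longrightarrow> bridged T (\<lambda>x. G x - T * s * x)"
  unfolding bridged_def
proof
  fix x assume "\<forall>x. \<exists>p q. (p, q) \<noteq> (0, 0) \<and> G x - 1 \<le> T * q + G (x + p) \<and> G x - 1 \<le> G (x - p) - T * q"
  then obtain p q where "(p, q) \<noteq> (0, 0)" "G x - 1 \<le> T * q + G (x + p)" "G x - 1 \<le> G (x - p) - T * q"
    by metis
  then show "\<exists>p q. (p, q) \<noteq> (0, 0) \<and> G x - T * s * x - 1 \<le> T * q + (G (x + p) - T * s * (x + p)) \<and>
      G x - T * s * x - 1 \<le> G (x - p) - T * s * (x - p) - T * q"
    by (intro exI[of _ p] exI[of _ "q + s * p"]) (auto simp: algebra_simps)
qed

subsection \<open>Comparison of a parabola with sheared fronts\<close>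

text \<open>The front of level 0 has height \<open>- G x / T\<close>, so \<open>K\<close> bounds its
  vertical distance from a parabola. The linear term is left free because integer shears change
  it.\<close>

definition near_parabola :: "int \<Rightarrow> (int \<Rightarrow> int) \<Rightarrow> real \<Rightarrow> bool" where
  "near_parabola T G A \<longleftrightarrow> (\<exists>\<beta> K. \<forall>x. \<bar>of_int (G x) / of_int T + (A / 2 * (of_int x)\<^sup>2 + \<beta> * of_int x)\<bar> \<le> K)"

text \<open>Completing the square. In the application \<open>e\<close> is the slope mismatch that
  remains after the shear has been rounded to an integer.\<close>

lemma quadratic_ge:
  fixes d e h :: real
  assumes "0 < d" "\<bar>e\<bar> \<le> 1"
  shows "- (1 / (2 * d)) \<le> d / 2 * h\<^sup>2 + e * h"
proof -
  have "0 \<le> (d * h + e)\<^sup>2" by simp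
  moreover have "e\<^sup>2 \<le> 1" using assms(2) by (simp add: abs_square_le_1)
  ultimately have "- 1 \<le> d * (d * h\<^sup>2 + 2 * e * h)"
    by (simp add: power2_eq_square algebra_simps)
  then show ?thesis using assms(1) by (simp add: field_simps)
qed

lemma quadratic_le:
  fixes d e h :: real
  assumes "d < 0" "\<bar>e\<bar> \<le> 1"
  shows "d / 2 * h\<^sup>2 + e * h \<le> - (1 / (2 * d))"
  using quadratic_ge[of "- d" "- e" h] assms by simp

text \<open>Compares with the parabola of second derivative \<open>A\<close> through the same point
  at \<open>y\<close>; the linear coefficient of the error is the slope difference there.\<close>

lemma quadratic_expand:
  fixes a b c A B x y :: real
  shows "a / 2 * x\<^sup>2 + b * x + c = A / 2 * x\<^sup>2 + B * x + (a / 2 * y\<^sup>2 + b * y + c - A / 2 * y\<^sup>2 - B * y) +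
    ((a - A) / 2 * (x - y)\<^sup>2 + ((a - A) * y + b - B) * (x - y))"
  by (simp add: power2_eq_square field_simps)

lemma floor_mult_divide_ge:
  fixes T X :: real
  assumes "0 < T"
  shows "X - 1 / T \<le> of_int \<lfloor>T * X\<rfloor> / T"
proof -
  have "T * X - 1 \<le> of_int \<lfloor>T * X\<rfloor>" by linarith
  then have "(X - 1 / T) * T \<le> of_int \<lfloor>T * X\<rfloor>" using assms by (simp add: algebra_simps)
  then show ?thesis using assms by (simp add: pos_le_divide_eq)
qed

lemma ceiling_mult_divide_le:
  fixes T X :: real
  assumes "0 < T"
  shows "of_int \<lceil>T * X\<rceil> / T \<le> X + 1 / T"
proof -
  have "of_int \<lceil>T * X\<rceil> \<le> T * X + 1" by linarith
  then show ?thesis using assms by (simp add: field_simps)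
qed

lemma convex_quadratic_epigraph:
  fixes A \<beta> \<gamma> :: real
  assumes "0 \<le> A"
  shows "convex {z. A / 2 * (fst z)\<^sup>2 + \<beta> * fst z + \<gamma> \<le> snd z}"
proof -
  have "convex_on UNIV (\<lambda>x. A / 2 * x\<^sup>2 + \<beta> * x + \<gamma>)"
  proof (rule convex_onI)
    fix t x y :: real assume "0 < t" "t < 1"
    then have "0 \<le> A / 2 * (t * (1 - t)) * (x - y)\<^sup>2"
      using assms by (intro mult_nonneg_nonneg) auto
    moreover have "(1 - t) * (A / 2 * x\<^sup>2 + \<beta> * x + \<gamma>) + t * (A / 2 * y\<^sup>2 + \<beta> * y + \<gamma>) -
        (A / 2 * ((1 - t) *\<^sub>R x + t *\<^sub>R y)\<^sup>2 + \<beta> * ((1 - t) *\<^sub>R x + t *\<^sub>R y) + \<gamma>) =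
        A / 2 * (t * (1 - t)) * (x - y)\<^sup>2"
      by (simp add: power2_eq_square field_simps)
    ultimately show "A / 2 * ((1 - t) *\<^sub>R x + t *\<^sub>R y)\<^sup>2 + \<beta> * ((1 - t) *\<^sub>R x + t *\<^sub>R y) + \<gamma> \<le>
        (1 - t) * (A / 2 * x\<^sup>2 + \<beta> * x + \<gamma>) + t * (A / 2 * y\<^sup>2 + \<beta> * y + \<gamma>)"
      by linarith
  qed simp
  then show ?thesis
    using convex_epigraph[of UNIV "\<lambda>x. A / 2 * x\<^sup>2 + \<beta> * x + \<gamma>"] by (simp add: epigraph_def)
qed

text \<open>For every \<open>x\<^sub>0\<close> its own sheared front is placed below the more
  strongly curved parabola, nearly touching it at \<open>x\<^sub>0\<close>. By monotonicity it stays
  below, and the initial gap at \<open>x\<^sub>0\<close> is bounded uniformly.\<close>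

lemma below_peeled_near_parabola:
  fixes a b c A :: real and T :: int
  assumes T: "1 \<le> T" and exp: "exposed T G" and near: "near_parabola T G A" and A: "0 < A" "A < a"
  defines "g \<equiv> \<lambda>x. a / 2 * x\<^sup>2 + b * x + c"
  shows "\<exists>C. \<forall>m. below_peeled g m (real m / real_of_int T - C)"
proof -
  obtain \<beta> K where K: "\<And>x. \<bar>real_of_int (G x) / real_of_int T + (A / 2 * (real_of_int x)\<^sup>2 + \<beta> * real_of_int x)\<bar> \<le> K"
    using near unfolding near_parabola_def by blast
  define d where "d = a - A"
  have d: "0 < d" using A by (simp add: d_def)
  \<comment> \<open>The summands pay for the slope mismatch, for passing between front and parabola
    at the start and at the end, and for rounding the level.\<close>
  let ?C = "1 / (2 * d) + 2 * K + 1 / real_of_int T"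
  have "g x\<^sub>0 + (real m / real_of_int T - ?C) \<le> lb (peeled_hull g m) x\<^sub>0"
    if "x\<^sub>0 \<in> lb_dom (peeled_hull g m)" for x\<^sub>0 m
  proof -
    \<comment> \<open>With this integer shear the slopes of the two parabolas at
      \<open>x\<^sub>0\<close> differ by less than 1.\<close>
    define s where "s = \<lfloor>(a - A) * x\<^sub>0 + b - \<beta>\<rfloor>"
    define e where "e = (a - A) * x\<^sub>0 + b - (\<beta> + real_of_int s)"
    define V where "V = g x\<^sub>0 - A / 2 * x\<^sub>0\<^sup>2 - (\<beta> + real_of_int s) * x\<^sub>0"
    define M where "M = \<lfloor>real_of_int T * (V - 1 / (2 * d) - K)\<rfloor>"
    define G' where "G' = (\<lambda>x. G x - T * s * x)"
    have e: "\<bar>e\<bar> \<le> 1" unfolding e_def s_def by linarith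
    have M1: "real_of_int M / real_of_int T \<le> V - 1 / (2 * d) - K"
      using T by (simp add: M_def pos_divide_le_eq mult.commute)
    have M2: "V - 1 / (2 * d) - K - 1 / real_of_int T \<le> real_of_int M / real_of_int T"
      unfolding M_def using T by (intro floor_mult_divide_ge) simp
    have wave_real: "(M' \<le> T * y + G' x) \<longleftrightarrow>
        real_of_int M' / real_of_int T \<le> (real_of_int y - real_of_int s * real_of_int x + real_of_int (G x) / real_of_int T :: real)" for M' x y
    proof -
      have "(M' \<le> T * y + G' x) \<longleftrightarrow> real_of_int M' \<le> (real_of_int (T * y + G' x) :: real)" by linarith
      then show ?thesis using T by (simp add: G'_def field_simps)
    qed
    have g_eq: "g x = A / 2 * x\<^sup>2 + (\<beta> + real_of_int s) * x + V + (d / 2 * (x - x\<^sub>0)\<^sup>2 + e * (x - x\<^sub>0))" for x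
      unfolding V_def e_def g_def d_def by (rule quadratic_expand)
    have "U0 g \<subseteq> wave T G' M"
    proof
      fix z assume "z \<in> U0 g"
      then obtain x y where z: "z = (real_of_int x, real_of_int y)" and y: "g (real_of_int x) \<le> real_of_int y"
        by (cases z) (auto simp: U0_def elim!: Ints_cases)
      have "A / 2 * (real_of_int x)\<^sup>2 + (\<beta> + real_of_int s) * real_of_int x + V - 1 / (2 * d) \<le> real_of_int y"
        using y g_eq[of "real_of_int x"] quadratic_ge[OF d e, of "real_of_int x - x\<^sub>0"] by linarith
      then have "real_of_int M / real_of_int T \<le> real_of_int y - real_of_int s * real_of_int x + real_of_int (G x) / real_of_int T"
        using K[of x] M1 unfolding distrib_right by linarith
      then show "z \<in> wave T G' M" unfolding z wave_iff wave_real .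
    qed
    then have "(peel ^^ m) (U0 g) \<subseteq> wave T G' (M + int m)"
      using peel_funpow_wave_subset[OF exposed_shear[OF exp, of s]]
      unfolding G'_def by (blast dest: peel_funpow_mono)
    also have "\<dots> \<subseteq> {z. A / 2 * (fst z)\<^sup>2 + (\<beta> + real_of_int s) * fst z + (real_of_int (M + int m) / real_of_int T - K) \<le> snd z}"
    proof
      fix z assume "z \<in> wave T G' (M + int m)"
      then obtain x y where z: "z = (real_of_int x, real_of_int y)" and "M + int m \<le> T * y + G' x"
        by (auto simp: wave_def)
      then have "real_of_int (M + int m) / real_of_int T \<le> real_of_int y - real_of_int s * real_of_int x + real_of_int (G x) / real_of_int T"
        unfolding wave_real by blast
      then show "z \<in> {z. A / 2 * (fst z)\<^sup>2 + (\<beta> + real_of_int s) * fst z + (real_of_int (M + int m) / real_of_int T - K) \<le> snd z}"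
        using K[of x] unfolding z distrib_right mem_Collect_eq fst_conv snd_conv by linarith
    qed
    \<comment> \<open>The epigraph is convex, so the bound for the remaining lattice points passes
      to their hull.\<close>
    finally have "peeled_hull g m \<subseteq> {z. A / 2 * (fst z)\<^sup>2 + (\<beta> + real_of_int s) * fst z + (real_of_int (M + int m) / real_of_int T - K) \<le> snd z}"
      unfolding peeled_hull_def using convex_quadratic_epigraph A(1) by (intro hull_minimal) auto
    then have "A / 2 * x\<^sub>0\<^sup>2 + (\<beta> + real_of_int s) * x\<^sub>0 + (real_of_int (M + int m) / real_of_int T - K) \<le> lb (peeled_hull g m) x\<^sub>0"
      using that unfolding lb_def lb_dom_def by (intro cInf_greatest) auto
    then show ?thesis
      using M2 by (simp add: V_def add_divide_distrib)
  qed
  then show ?thesis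
    unfolding below_peeled_def by blast
qed

text \<open>The mirrored comparison: the front is more strongly curved, starts inside
  \<open>U0 g\<close>, and the part of it that survives bounds the hull from above.\<close>

lemma above_peeled_near_parabola:
  fixes a b c A :: real and T :: int
  assumes T: "1 \<le> T" and br: "bridged T G" and near: "near_parabola T G A" and A: "0 < a" "a < A"
  defines "g \<equiv> \<lambda>x. a / 2 * x\<^sup>2 + b * x + c"
  shows "\<exists>C. \<forall>m. lb_dom (peeled_hull g m) = UNIV \<and> above_peeled g m (real m / real_of_int T + C)"
proof -
  obtain \<beta> K where K: "\<And>x. \<bar>real_of_int (G x) / real_of_int T + (A / 2 * (real_of_int x)\<^sup>2 + \<beta> * real_of_int x)\<bar> \<le> K"
    using near unfolding near_parabola_def by blast
  define d where "d = a - A"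
  have d: "d < 0" using A by (simp add: d_def)
  let ?C = "- (1 / (2 * d)) + 2 * K + 1 / real_of_int T + A + 1"
  have "x\<^sub>0 \<in> lb_dom (peeled_hull g m) \<and> lb (peeled_hull g m) x\<^sub>0 \<le> g x\<^sub>0 + (real m / real_of_int T + ?C)" for x\<^sub>0 m
  proof -
    define s where "s = \<lfloor>(a - A) * x\<^sub>0 + b - \<beta>\<rfloor>"
    define e where "e = (a - A) * x\<^sub>0 + b - (\<beta> + real_of_int s)"
    define V where "V = g x\<^sub>0 - A / 2 * x\<^sub>0\<^sup>2 - (\<beta> + real_of_int s) * x\<^sub>0"
    define M where "M = \<lceil>real_of_int T * (V - 1 / (2 * d) + K)\<rceil>"
    define G' where "G' = (\<lambda>x. G x - T * s * x)"
    have e: "\<bar>e\<bar> \<le> 1" unfolding e_def s_def by linarith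
    have M1: "V - 1 / (2 * d) + K \<le> real_of_int M / real_of_int T"
      using T by (simp add: M_def pos_le_divide_eq mult.commute)
    have M2: "real_of_int M / real_of_int T \<le> V - 1 / (2 * d) + K + 1 / real_of_int T"
      unfolding M_def using T by (intro ceiling_mult_divide_le) simp
    have wave_real: "(M' \<le> T * y + G' x) \<longleftrightarrow>
        real_of_int M' / real_of_int T \<le> (real_of_int y - real_of_int s * real_of_int x + real_of_int (G x) / real_of_int T :: real)" for M' x y
    proof -
      have "(M' \<le> T * y + G' x) \<longleftrightarrow> real_of_int M' \<le> (real_of_int (T * y + G' x) :: real)" by linarith
      then show ?thesis using T by (simp add: G'_def field_simps)
    qed
    have g_eq: "g x = A / 2 * x\<^sup>2 + (\<beta> + real_of_int s) * x + V + (d / 2 * (x - x\<^sub>0)\<^sup>2 + e * (x - x\<^sub>0))" for x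
      unfolding V_def e_def g_def d_def by (rule quadratic_expand)
    have "wave T G' M \<subseteq> U0 g"
    proof
      fix z assume "z \<in> wave T G' M"
      then obtain x y where z: "z = (real_of_int x, real_of_int y)" and "M \<le> T * y + G' x"
        by (auto simp: wave_def)
      then have "real_of_int M / real_of_int T \<le> real_of_int y - real_of_int s * real_of_int x + real_of_int (G x) / real_of_int T"
        unfolding wave_real by blast
      then have "A / 2 * (real_of_int x)\<^sup>2 + (\<beta> + real_of_int s) * real_of_int x + V - 1 / (2 * d) \<le> real_of_int y"
        using K[of x] M1 unfolding distrib_right by linarith
      then show "z \<in> U0 g"
        using g_eq[of "real_of_int x"] quadratic_le[OF d e, of "real_of_int x - x\<^sub>0"] by (simp add: U0_def z)
    qed
    then have sub: "wave T G' (M + int m) \<subseteq> (peel ^^ m) (U0 g)"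
      using wave_subset_peel_funpow[OF bridged_shear[OF br, of s]]
      unfolding G'_def by (blast dest: peel_funpow_mono)
    \<comment> \<open>Peeling only removes points, so the hull stays above \<open>g\<close>; this
      makes the set in \<open>lb\<close> bounded below and its \<open>Inf\<close>
      meaningful.\<close>
    have "peel ^^ m \<le> id" for m
      by (induction m) (auto simp: le_fun_def peel_def)
    then have "(peel ^^ m) (U0 g) \<subseteq> U0 g" by (simp add: le_fun_def)
    also have "\<dots> \<subseteq> {z. a / 2 * (fst z)\<^sup>2 + b * fst z + c \<le> snd z}" by (auto simp: U0_def g_def)
    finally have low: "peeled_hull g m \<subseteq> {z. a / 2 * (fst z)\<^sup>2 + b * fst z + c \<le> snd z}"
      unfolding peeled_hull_def using convex_quadratic_epigraph A(1) by (intro hull_minimal) auto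
    define \<kappa> where "\<kappa> = real_of_int (M + int m) / real_of_int T + K"
    define Y where "Y = (\<lambda>x. A / 2 * x\<^sup>2 + (\<beta> + real_of_int s) * x + \<kappa>)"
    have in_hull: "(real_of_int x, real_of_int \<lceil>Y (real_of_int x)\<rceil>) \<in> peeled_hull g m" for x
    proof -
      have "Y (real_of_int x) \<le> real_of_int \<lceil>Y (real_of_int x)\<rceil>" by simp
      then have "real_of_int (M + int m) / real_of_int T \<le> real_of_int \<lceil>Y (real_of_int x)\<rceil> - real_of_int s * real_of_int x + real_of_int (G x) / real_of_int T"
        using K[of x] unfolding Y_def \<kappa>_def distrib_right by linarith
      then have "(real_of_int x, real_of_int \<lceil>Y (real_of_int x)\<rceil>) \<in> wave T G' (M + int m)"
        unfolding wave_iff wave_real .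
      then show ?thesis unfolding peeled_hull_def using sub by (auto intro: hull_inc)
    qed
    \<comment> \<open>The front supplies hull points over integers only. Interpolating between two
      neighbours costs a chord error of at most \<open>A\<close> and a rounding error of at most
      1.\<close>
    define x1 where "x1 = \<lfloor>x\<^sub>0\<rfloor>"
    define t where "t = x\<^sub>0 - real_of_int x1"
    have t: "0 \<le> t" "t \<le> 1" unfolding t_def x1_def by linarith+
    define y where "y = (1 - t) * real_of_int \<lceil>Y (real_of_int x1)\<rceil> + t * real_of_int \<lceil>Y (real_of_int (x1 + 1))\<rceil>"
    have "(1 - t) *\<^sub>R (real_of_int x1, real_of_int \<lceil>Y (real_of_int x1)\<rceil>) + t *\<^sub>R (real_of_int (x1 + 1), real_of_int \<lceil>Y (real_of_int (x1 + 1))\<rceil>) \<in> peeled_hull g m"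
      using in_hull[of x1] in_hull[of "x1 + 1"] t unfolding peeled_hull_def
      by (intro convexD[OF convex_convex_hull]) auto
    moreover have "(1 - t) * real_of_int x1 + t * real_of_int (x1 + 1) = x\<^sub>0" by (simp add: t_def algebra_simps)
    ultimately have mem: "(x\<^sub>0, y) \<in> peeled_hull g m" by (simp add: y_def)
    have "y \<le> (1 - t) * (Y (real_of_int x1) + 1) + t * (Y (real_of_int (x1 + 1)) + 1)"
      unfolding y_def using t by (intro add_mono mult_left_mono) linarith+
    also have "\<dots> = Y x\<^sub>0 + A / 2 * (t * (1 - t)) + 1"
    proof -
      have "x\<^sub>0 = real_of_int x1 + t" by (simp add: t_def)
      then show ?thesis unfolding Y_def by (simp add: power2_eq_square field_simps)
    qed
    also have "\<dots> \<le> Y x\<^sub>0 + A + 1"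
    proof -
      have "t * (1 - t) \<le> 1" using t by (simp add: mult_le_one)
      then have "A / 2 * (t * (1 - t)) \<le> A / 2 * 1" using A by (intro mult_left_mono) auto
      then show ?thesis using A by simp
    qed
    also have "\<dots> \<le> g x\<^sub>0 + (real m / real_of_int T + ?C)"
      using M2 unfolding Y_def \<kappa>_def V_def by (simp add: add_divide_distrib)
    finally have "y \<le> g x\<^sub>0 + (real m / real_of_int T + ?C)" .
    moreover have "lb (peeled_hull g m) x\<^sub>0 \<le> y"
      unfolding lb_def using mem low by (intro cInf_lower bdd_belowI[where m = "g x\<^sub>0"]) (auto simp: g_def)
    ultimately show ?thesis using mem by (auto simp: lb_dom_def)
  qed
  then have "\<forall>m. lb_dom (peeled_hull g m) = UNIV \<and> above_peeled g m (real m / real_of_int T + ?C)"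
    unfolding above_peeled_def by blast
  then show ?thesis by blast
qed

section \<open>From bounds at every step to average speeds\<close>

lemma v_minus_ge:
  fixes T :: int
  assumes "1 \<le> T" "\<forall>m. below_peeled g m (real m / of_int T - C)"
  shows "ereal (1 / of_int T) \<le> v_minus g"
proof -
  have "(\<lambda>m. ereal (1 / of_int T - C / real m)) \<longlonglongrightarrow> ereal (1 / of_int T - 0)"
    by (intro tendsto_ereal tendsto_diff tendsto_const tendsto_divide_0[OF tendsto_const])
      (simp add: filterlim_real_sequentially filterlim_at_top_imp_at_infinity)
  then have lim: "liminf (\<lambda>m. ereal (1 / of_int T - C / real m)) = ereal (1 / of_int T)"
    by (simp add: lim_imp_Liminf)
  have "liminf (\<lambda>m. ereal (1 / of_int T - C / real m)) \<le> v_minus g"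
    unfolding v_minus_def
  proof (intro Liminf_mono eventually_mono[OF eventually_gt_at_top[of 0]])
    fix m :: nat assume m: "0 < m"
    have "ereal (real m / of_int T - C) / ereal (real m) \<le> Sup (ereal ` {\<gamma>. below_peeled g m \<gamma>}) / ereal (real m)"
      using assms(2) m by (intro ereal_divide_right_mono Sup_upper) auto
    then show "ereal (1 / of_int T - C / real m) \<le> Sup (ereal ` {\<gamma>. below_peeled g m \<gamma>}) / ereal (real m)"
      using m by (simp add: diff_divide_distrib)
  qed
  then show ?thesis using lim by simp
qed

lemma v_plus_le:
  fixes T :: int
  assumes "1 \<le> T" "\<forall>m. above_peeled g m (real m / of_int T + C)"
  shows "v_plus g \<le> ereal (1 / of_int T)"
proof -
  have "(\<lambda>m. ereal (1 / of_int T + C / real m)) \<longlonglongrightarrow> ereal (1 / of_int T + 0)"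
    by (intro tendsto_ereal tendsto_add tendsto_const tendsto_divide_0[OF tendsto_const])
      (simp add: filterlim_real_sequentially filterlim_at_top_imp_at_infinity)
  then have lim: "limsup (\<lambda>m. ereal (1 / of_int T + C / real m)) = ereal (1 / of_int T)"
    by (simp add: lim_imp_Limsup)
  have "v_plus g \<le> limsup (\<lambda>m. ereal (1 / of_int T + C / real m))"
    unfolding v_plus_def
  proof (intro Limsup_mono eventually_mono[OF eventually_gt_at_top[of 0]])
    fix m :: nat assume m: "0 < m"
    have "Inf (ereal ` {\<gamma>. above_peeled g m \<gamma>}) / ereal (real m) \<le> ereal (real m / of_int T + C) / ereal (real m)"
      using assms(2) m by (intro ereal_divide_right_mono Inf_lower) auto
    then show "Inf (ereal ` {\<gamma>. above_peeled g m \<gamma>}) / ereal (real m) \<le> ereal (1 / of_int T + C / real m)"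
      using m by (simp add: add_divide_distrib)
  qed
  then show ?thesis using lim by simp
qed

lemma v_minus_le_v_plus:
  assumes "\<And>m. lb_dom (peeled_hull g m) \<noteq> {}"
  shows "v_minus g \<le> v_plus g"
proof -
  have "v_minus g \<le> liminf (\<lambda>m. Inf (ereal ` {\<gamma>. above_peeled g m \<gamma>}) / ereal (real m))"
    unfolding v_minus_def
  proof (intro Liminf_mono eventually_mono[OF eventually_gt_at_top[of 0]] ereal_divide_right_mono)
    fix m :: nat assume "0 < m"
    then show "0 < ereal (real m)" by simp
    \<comment> \<open>One common column compares \<open>\<gamma>\<close> with
      \<open>\<delta>\<close>; over an empty domain both predicates would hold vacuously.\<close>
    obtain x where "x \<in> lb_dom (peeled_hull g m)" using assms by blast
    then have "\<gamma> \<le> \<delta>" if "below_peeled g m \<gamma>" "above_peeled g m \<delta>" for \<gamma> \<delta>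
      using that unfolding below_peeled_def above_peeled_def by force
    then show "Sup (ereal ` {\<gamma>. below_peeled g m \<gamma>}) \<le> Inf (ereal ` {\<gamma>. above_peeled g m \<gamma>})"
      by (auto intro!: Sup_least Inf_greatest)
  qed
  also have "\<dots> \<le> v_plus g"
    unfolding v_plus_def by (rule Liminf_le_Limsup) simp
  finally show ?thesis .
qed

subsection \<open>Bi-infinite sequences of consecutive slopes with bounded denominator\<close>

lemma minus_one_div_int:
  fixes m d :: int
  assumes "1 \<le> d"
  shows "(m - 1) div d = m div d - of_bool (d dvd m)"
proof (cases "d dvd m")
  case True
  then obtain k where m: "m = d * k" by blast
  have "(m - 1) div d = (d - 1 + d * (k - 1)) div d" by (simp add: m algebra_simps)
  also have "\<dots> = k - 1" using assms by simp
  finally show ?thesis using True m assms by simp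
next
  case False
  then have "m mod d \<noteq> 0" by (simp add: dvd_eq_mod_eq_0)
  moreover have "0 \<le> m mod d" "m mod d < d" using assms by simp_all
  ultimately have "(m - 1) div d = m div d"
    by (intro int_div_pos_eq[of "m - 1" d "m div d" "m mod d - 1"]) simp_all
  then show ?thesis using False by simp
qed

lemma dvd_abs_less_imp_zero: "(d::int) dvd v \<Longrightarrow> \<bar>v\<bar> < d \<Longrightarrow> v = 0"
  using zdvd_imp_le[of d "\<bar>v\<bar>"] by (cases "v = 0") auto

lemma floor_eqI: "(\<And>u. of_int u \<le> (x::real) \<longleftrightarrow> u \<le> m) \<Longrightarrow> \<lfloor>x\<rfloor> = m"
  by (metis dual_order.refl eq_iff le_floor_iff)

lemma le_div_iff: "0 < d \<Longrightarrow> (u::int) \<le> m div d \<longleftrightarrow> u * d \<le> m"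
proof
  assume d: "0 < d"
  assume "u \<le> m div d"
  then have "u * d \<le> m div d * d" using d by (simp add: mult_right_mono)
  then show "u * d \<le> m" using div_mult_mod_eq[of m d] pos_mod_sign[OF d, of m] by linarith
next
  assume "0 < d" "u * d \<le> m"
  then show "u \<le> m div d" using zdiv_mono1[of "u * d" m d] by simp
qed

text \<open>\<open>consecutive\<close> keeps fractions of denominator at most \<open>n\<close> out
  of the open gaps. The irrational \<open>\<rho>\<close> yields in each gap a slope such that no
  line of that slope meets two lattice points.\<close>

locale slope_sequence =
  fixes n :: int and p q :: "int \<Rightarrow> int" and \<rho> :: real
  assumes p_pos: "1 \<le> p i" and p_le: "p i \<le> n" and coprime: "coprime (p i) (q i)"
    and increasing: "q i * p (i + 1) < q (i + 1) * p i"
    and consecutive: "0 < v \<Longrightarrow> v \<le> n \<Longrightarrow> u * p i \<le> q i * v \<or> q (i + 1) * v \<le> u * p (i + 1)"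
    and \<rho>: "0 < \<rho>" "\<rho> < 1" "\<rho> \<notin> \<rat>"
begin

definition slope :: "int \<Rightarrow> real" where
  "slope i = of_int (q i) / of_int (p i)"

definition \<sigma> :: "int \<Rightarrow> real" where
  "\<sigma> i = slope i + \<rho> * (slope (i + 1) - slope i)"

lemma slope_less_Suc: "slope i < slope (i + 1)"
proof -
  have "real_of_int (q i * p (i + 1)) < real_of_int (q (i + 1) * p i)"
    using increasing by (simp only: of_int_less_iff)
  then show ?thesis
    using p_pos[of i] p_pos[of "i + 1"] by (simp add: slope_def field_simps)
qed

lemma \<sigma>_bounds: "slope i < \<sigma> i" "\<sigma> i < slope (i + 1)"
proof -
  have pos: "0 < slope (i + 1) - slope i" using slope_less_Suc by simp
  show "slope i < \<sigma> i" using pos \<rho> by (simp add: \<sigma>_def)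
  have "\<rho> * (slope (i + 1) - slope i) < 1 * (slope (i + 1) - slope i)"
    using pos \<rho> by (intro mult_strict_right_mono)
  then show "\<sigma> i < slope (i + 1)" by (simp add: \<sigma>_def)
qed

lemma \<sigma>_irrational: "\<sigma> i \<notin> \<rat>"
proof
  assume "\<sigma> i \<in> \<rat>"
  moreover have "slope i \<in> \<rat>" "slope (i + 1) \<in> \<rat>" by (auto simp: slope_def)
  ultimately have "(\<sigma> i - slope i) / (slope (i + 1) - slope i) \<in> \<rat>"
    by auto
  moreover have "(\<sigma> i - slope i) / (slope (i + 1) - slope i) = \<rho>"
    using slope_less_Suc[of i] by (simp add: \<sigma>_def)
  ultimately show False using \<rho> by simp
qed

text \<open>No \<open>u / v\<close> lies strictly inside the gap, so comparing it with
  \<open>\<sigma> i\<close> amounts to comparing it with either end of the gap.\<close>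

lemma less_\<sigma>_iff:
  assumes "0 < v" "v \<le> n"
  shows "of_int u < \<sigma> i * of_int v \<longleftrightarrow> u * p i \<le> q i * v"
    and "of_int u < \<sigma> i * of_int v \<longleftrightarrow> u * p (i + 1) < q (i + 1) * v"
proof -
  have v: "0 < real_of_int v" using assms by simp
  have le: "of_int u \<le> slope j * of_int v \<longleftrightarrow> u * p j \<le> q j * v" for j
  proof -
    have "u * p j \<le> q j * v \<longleftrightarrow> real_of_int (u * p j) \<le> real_of_int (q j * v)" by (simp only: of_int_le_iff)
    then show ?thesis using p_pos[of j] by (simp add: slope_def field_simps)
  qed
  have ge: "slope j * of_int v \<le> of_int u \<longleftrightarrow> q j * v \<le> u * p j" for j
  proof -
    have "q j * v \<le> u * p j \<longleftrightarrow> real_of_int (q j * v) \<le> real_of_int (u * p j)" by (simp only: of_int_le_iff)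
    then show ?thesis using p_pos[of j] by (simp add: slope_def field_simps)
  qed
  have l: "slope i * of_int v < \<sigma> i * of_int v" and r: "\<sigma> i * of_int v < slope (i + 1) * of_int v"
    using \<sigma>_bounds[of i] v by simp_all
  have "u * p i \<le> q i * v \<or> q (i + 1) * v \<le> u * p (i + 1)" using consecutive assms by blast
  then have "of_int u \<le> slope i * of_int v \<or> slope (i + 1) * of_int v \<le> of_int u"
    unfolding le ge .
  then show "of_int u < \<sigma> i * of_int v \<longleftrightarrow> u * p i \<le> q i * v"
    and "of_int u < \<sigma> i * of_int v \<longleftrightarrow> u * p (i + 1) < q (i + 1) * v"
    unfolding le[symmetric] not_le[symmetric] ge[symmetric] using l r by linarith+
qed

section \<open>Floors of multiples of the sweep slopes\<close>

lemma \<sigma>_mult_neq_int: "v \<noteq> 0 \<Longrightarrow> \<sigma> i * of_int v \<noteq> of_int u"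
proof
  assume "v \<noteq> 0" "\<sigma> i * of_int v = of_int u"
  then have "\<sigma> i = of_int u / of_int v" by (simp add: field_simps)
  then show False using \<sigma>_irrational[of i] by simp
qed

text \<open>\<open>\<sigma> i\<close> acts like a number just above \<open>slope i\<close>: for
  negative \<open>v\<close> the product falls just below the rational one, whence the
  \<open>- 1\<close>.\<close>

lemma floor_\<sigma>_left:
  assumes "\<bar>v\<bar> \<le> n"
  shows "\<lfloor>\<sigma> i * of_int v\<rfloor> = (if 0 \<le> v then q i * v div p i else (q i * v - 1) div p i)"
proof (cases "v = 0")
  case False
  have p: "0 < p i" using p_pos[of i] by simp
  show ?thesis
  proof (cases "0 < v")
    case True
    have "of_int u \<le> \<sigma> i * of_int v \<longleftrightarrow> u \<le> q i * v div p i" for u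
      using less_\<sigma>_iff(1)[of v u i] \<sigma>_mult_neq_int[of v i u] True assms p
      unfolding le_div_iff[OF p] by linarith
    then show ?thesis using True by (simp add: floor_eqI)
  next
    case neg: False
    have "of_int u \<le> \<sigma> i * of_int v \<longleftrightarrow> u \<le> (q i * v - 1) div p i" for u
      using less_\<sigma>_iff(1)[of "- v" "- u" i] neg False assms p
      by (auto simp: le_div_iff)
    then show ?thesis using neg False by (simp add: floor_eqI)
  qed
qed simp

lemma floor_\<sigma>_right:
  assumes "\<bar>v\<bar> \<le> n"
  shows "\<lfloor>\<sigma> i * of_int v\<rfloor> = (if v \<le> 0 then q (i + 1) * v div p (i + 1) else (q (i + 1) * v - 1) div p (i + 1))"
proof (cases "v = 0")
  case False
  have p: "0 < p (i + 1)" using p_pos[of "i + 1"] by simp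
  show ?thesis
  proof (cases "0 < v")
    case True
    have "of_int u \<le> \<sigma> i * of_int v \<longleftrightarrow> u \<le> (q (i + 1) * v - 1) div p (i + 1)" for u
      using less_\<sigma>_iff(2)[of v u i] \<sigma>_mult_neq_int[of v i u] True assms p
      unfolding le_div_iff[OF p] by linarith
    then show ?thesis using True by (simp add: floor_eqI)
  next
    case neg: False
    have "of_int u \<le> \<sigma> i * of_int v \<longleftrightarrow> u \<le> q (i + 1) * v div p (i + 1)" for u
      using less_\<sigma>_iff(2)[of "- v" "- u" i] neg False assms p
      by (auto simp: le_div_iff)
    then show ?thesis using neg False by (simp add: floor_eqI)
  qed
qed simp

lemma floor_slope: "\<lfloor>slope i * of_int v\<rfloor> = q i * v div p i"
proof -
  have "slope i * of_int v = of_int (q i * v) / of_int (p i)" by (simp add: slope_def)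
  then show ?thesis by (simp only: floor_divide_of_int_eq)
qed

lemma floor_\<sigma>_le: "v \<le> 0 \<Longrightarrow> \<lfloor>\<sigma> i * of_int v\<rfloor> \<le> q i * v div p i"
  using \<sigma>_bounds(1)[of i] unfolding floor_slope[symmetric] by (intro floor_mono mult_right_mono_neg) auto

lemma floor_\<sigma>_ge: "0 \<le> v \<Longrightarrow> q i * v div p i \<le> \<lfloor>\<sigma> i * of_int v\<rfloor>"
  using \<sigma>_bounds(1)[of i] unfolding floor_slope[symmetric] by (intro floor_mono mult_right_mono) auto

lemma le_floor_\<sigma>: "v \<le> 0 \<Longrightarrow> q (i + 1) * v div p (i + 1) \<le> \<lfloor>\<sigma> i * of_int v\<rfloor>"
  using \<sigma>_bounds(2)[of i] unfolding floor_slope[symmetric] by (intro floor_mono mult_right_mono_neg) auto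

lemma ge_floor_\<sigma>: "0 \<le> v \<Longrightarrow> \<lfloor>\<sigma> i * of_int v\<rfloor> \<le> q (i + 1) * v div p (i + 1)"
  using \<sigma>_bounds(2)[of i] unfolding floor_slope[symmetric] by (intro floor_mono mult_right_mono) auto

lemma dvd_q_mult_iff: "p i dvd q i * v \<longleftrightarrow> p i dvd v"
  using coprime coprime_dvd_mult_right_iff by blast

lemma div_pred: "(q i * v - 1) div p i = q i * v div p i - of_bool (p i dvd v)"
  using minus_one_div_int[OF p_pos, of "q i * v" i] by (simp add: dvd_q_mult_iff)

lemma div_shift: "q i * (v + m * p i) div p i = q i * v div p i + m * q i"
proof -
  have "q i * (v + m * p i) = q i * v + (m * q i) * p i" by (simp add: algebra_simps)
  then show ?thesis using p_pos[of i] by simp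
qed

text \<open>The Bezout solution \<open>u / v\<close> whose denominator is the largest one not
  exceeding \<open>n\<close> turns out to be the next slope.\<close>

lemma farey_neighbours: "q (i + 1) * p i - q i * p (i + 1) = 1"
proof -
  let ?p = "p i" and ?q = "q i" and ?p' = "p (i + 1)" and ?q' = "q (i + 1)"
  obtain b0 a0 where "?p * b0 + ?q * a0 = 1"
    using coprime[of i] coprime_iff_gcd_eq_1 bezout_int by (metis mult.commute)
  \<comment> \<open>This multiple puts \<open>v\<close> into the window
    \<open>n - p i < v \<le> n\<close>.\<close>
  define m where "m = (n + a0) div ?p"
  define u where "u = b0 + m * ?q"
  define v where "v = m * ?p - a0"
  have 1: "?p * u - ?q * v = 1"
    using \<open>?p * b0 + ?q * a0 = 1\<close> by (simp add: u_def v_def algebra_simps)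
  have p: "0 < ?p" using p_pos[of i] by simp
  have v: "v \<le> n" "n < v + ?p"
    using div_mult_mod_eq[of "n + a0" ?p] pos_mod_bound[OF p, of "n + a0"] pos_mod_sign[OF p, of "n + a0"]
    unfolding v_def m_def by linarith+
  have "0 < v" using v p_le[of i] by simp
  have "\<not> u * ?p \<le> ?q * v" using 1 by (simp add: mult.commute)
  then have E: "0 \<le> u * ?p' - ?q' * v" using consecutive[OF \<open>0 < v\<close> v(1), of u i] by simp
  have D: "1 \<le> ?q' * ?p - ?q * ?p'" using increasing[of i] by simp
  have id: "?p * (u * ?p' - ?q' * v) + v * (?q' * ?p - ?q * ?p') = ?p'"
  proof -
    have "?p * (u * ?p' - ?q' * v) + v * (?q' * ?p - ?q * ?p') = ?p' * (?p * u - ?q * v)"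
      by (simp add: algebra_simps)
    then show ?thesis using 1 by simp
  qed
  have vD: "v \<le> v * (?q' * ?p - ?q * ?p')" using D \<open>0 < v\<close> by simp
  \<comment> \<open>Otherwise the identity would give
    \<open>p i + v \<le> p (i + 1) \<le> n\<close>, against the choice of \<open>v\<close>.\<close>
  have "u * ?p' - ?q' * v = 0"
  proof (rule ccontr)
    assume "u * ?p' - ?q' * v \<noteq> 0"
    then have "?p \<le> ?p * (u * ?p' - ?q' * v)" using E p by simp
    then show False using id vD v p_le[of "i + 1"] by linarith
  qed
  then have "u * ?p' = ?q' * v" and p': "?p' = v * (?q' * ?p - ?q * ?p')" using id by auto
  then have "v * ?q' = v * (u * (?q' * ?p - ?q * ?p'))"
    by (metis mult.assoc mult.commute)
  then have "?q' = u * (?q' * ?p - ?q * ?p')" using \<open>0 < v\<close> by simp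
  then have "(?q' * ?p - ?q * ?p') dvd ?q'" "(?q' * ?p - ?q * ?p') dvd ?p'"
    using p' by (metis dvd_triv_right)+
  then have "(?q' * ?p - ?q * ?p') dvd 1"
    using coprime[of "i + 1"] coprime_common_divisor by blast
  then show ?thesis using D by simp
qed

end

subsection \<open>The front attached to a slope sequence\<close>

text \<open>\<open>a i\<close> is the first column of the \<open>i\<close>-th strip. Up to a constant, \<open>T * y + Gi i x\<close> counts the lattice
  points of that strip on or below the line of slope \<open>\<sigma> i\<close> through \<open>(x, y)\<close>; the constants \<open>c i\<close> make these
  counts agree where consecutive strips overlap.\<close>

locale strips = slope_sequence +
  fixes T :: int and a c :: "int \<Rightarrow> int"
  assumes T_pos: "1 \<le> T" and T_le: "T - 1 \<le> n" and n_le: "n \<le> T"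
    and a_Suc: "a (i + 1) = a i + n div p (i + 1) * p (i + 1)"
    and c_Suc: "c (i + 1) = c i - T * (n div p (i + 1) * q (i + 1))"
begin

abbreviation k :: "int \<Rightarrow> int" where
  "k i \<equiv> n div p i"

lemma k_bounds: "1 \<le> k i" "k i * p i \<le> n" "n < k i * p i + p i" "p i \<le> k i * p i" "T \<le> k i * p i + p i" "0 \<le> k i * p i"
proof -
  have p: "0 < p i" using p_pos[of i] by simp
  show 1: "1 \<le> k i" using p p_le[of i] by (simp add: le_div_iff)
  show "k i * p i \<le> n" "n < k i * p i + p i"
    using div_mult_mod_eq[of n "p i"] pos_mod_bound[OF p, of n] pos_mod_sign[OF p, of n]
    by linarith+
  then show "T \<le> k i * p i + p i" using T_le by simp
  show "p i \<le> k i * p i" "0 \<le> k i * p i" using 1 p by simp_all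
qed

lemma a_less_Suc: "a i < a (i + 1)" "a (i + 1) \<le> a i + T"
  using k_bounds[of "i + 1"] p_pos[of "i + 1"] n_le by (simp_all add: a_Suc)

definition Gi :: "int \<Rightarrow> int \<Rightarrow> int" where
  "Gi i x = c i + (\<Sum>j\<in>{0..<T}. \<lfloor>\<sigma> i * of_int (a i + j - x)\<rfloor>)"

lemma sum_const_T: "(\<Sum>j\<in>{0..<T}. (m::int)) = T * m"
  using T_pos by simp

text \<open>Moves strip \<open>i + 1\<close> back by \<open>k (i + 1)\<close> times
  \<open>(p (i + 1), q (i + 1))\<close>, so that the sums for both strips can be compared term by
  term.\<close>

lemma Gi_Suc:
  "Gi (i + 1) x = c i + (\<Sum>j\<in>{0..<T}. \<lfloor>\<sigma> (i + 1) * of_int (a i + j - x + k (i + 1) * p (i + 1))\<rfloor> - k (i + 1) * q (i + 1))"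
  unfolding Gi_def c_Suc a_Suc sum_subtractf sum_const_T by (simp add: algebra_simps)

text \<open>Both floors are compared with the one for the common slope
  \<open>q (i + 1) / p (i + 1)\<close>; only positive multiples of \<open>p (i + 1)\<close> could
  spoil this.\<close>

lemma Gi_Suc_le:
  assumes x: "a (i + 1) \<le> x"
  shows "Gi (i + 1) x \<le> Gi i x"
proof -
  let ?p = "p (i + 1)" and ?q = "q (i + 1)" and ?k = "k (i + 1)"
  have "\<lfloor>\<sigma> (i + 1) * of_int (a i + j - x + ?k * ?p)\<rfloor> - ?k * ?q \<le> \<lfloor>\<sigma> i * of_int (a i + j - x)\<rfloor>"
    if "j \<in> {0..<T}" for j
  proof -
    define v where "v = a i + j - x"
    have v: "v + ?k * ?p < T" "v < T" using x that k_bounds(6)[of "i + 1"] by (auto simp: v_def a_Suc)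
    have "\<lfloor>\<sigma> (i + 1) * of_int (v + ?k * ?p)\<rfloor> \<le> ?q * (v + ?k * ?p) div ?p"
      using floor_\<sigma>_le[of "v + ?k * ?p" "i + 1"] floor_\<sigma>_left[of "v + ?k * ?p" "i + 1"] v T_le
      by (cases "v + ?k * ?p \<le> 0") auto
    moreover have "?q * v div ?p \<le> \<lfloor>\<sigma> i * of_int v\<rfloor>"
    proof (cases "v \<le> 0")
      \<comment> \<open>Here \<open>v < T - k (i + 1) * p (i + 1) \<le> p (i + 1)\<close>, so
        \<open>v\<close> is no such multiple.\<close>
      case False
      then have "\<not> ?p dvd v"
        using v k_bounds[of "i + 1"] dvd_abs_less_imp_zero[of ?p v] by auto
      then show ?thesis using False v T_le floor_\<sigma>_right[of v i] by (simp add: div_pred)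
    qed (rule le_floor_\<sigma>)
    ultimately show ?thesis by (simp add: v_def div_shift)
  qed
  then show ?thesis
    unfolding Gi_Suc unfolding Gi_def by (intro add_left_mono sum_mono)
qed


text \<open>The reverse comparison, now excluding negative multiples; both together make consecutive
  strips agree on their overlap.\<close>

lemma Gi_le_Suc:
  assumes x: "x < a i + T"
  shows "Gi i x \<le> Gi (i + 1) x"
proof -
  let ?p = "p (i + 1)" and ?q = "q (i + 1)" and ?k = "k (i + 1)"
  have "\<lfloor>\<sigma> i * of_int (a i + j - x)\<rfloor> \<le> \<lfloor>\<sigma> (i + 1) * of_int (a i + j - x + ?k * ?p)\<rfloor> - ?k * ?q"
    if "j \<in> {0..<T}" for j
  proof -
    define v where "v = a i + j - x"
    have v: "- T < v" "- ?p < v + ?k * ?p" "- T < v + ?k * ?p"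
      using x that k_bounds(5,6)[of "i + 1"] by (auto simp: v_def)
    have "?q * (v + ?k * ?p) div ?p \<le> \<lfloor>\<sigma> (i + 1) * of_int (v + ?k * ?p)\<rfloor>"
    proof (cases "0 \<le> v + ?k * ?p")
      case False
      then have "\<not> ?p dvd v + ?k * ?p"
        using v dvd_abs_less_imp_zero[of ?p "v + ?k * ?p"] by auto
      then show ?thesis using False v T_le floor_\<sigma>_left[of "v + ?k * ?p" "i + 1"] by (simp add: div_pred)
    qed (rule floor_\<sigma>_ge)
    moreover have "\<lfloor>\<sigma> i * of_int v\<rfloor> \<le> ?q * v div ?p"
      using ge_floor_\<sigma>[of v i] floor_\<sigma>_right[of v i] v T_le by (cases "0 \<le> v") auto
    ultimately show ?thesis by (simp add: v_def div_shift)
  qed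
  then show ?thesis
    unfolding Gi_Suc unfolding Gi_def by (intro add_left_mono sum_mono)
qed

lemma a_mono: "i \<le> j \<Longrightarrow> a i \<le> a j"
  by (induction j rule: int_ge_induct) (use a_less_Suc(1) in \<open>auto intro: order.trans less_imp_le\<close>)

text \<open>Walking away from strip \<open>j\<close>, the column \<open>x\<close> stays on the side
  where each further strip can only increase the value.\<close>

lemma Gi_min:
  assumes "a j \<le> x" "x < a j + T"
  shows "Gi j x \<le> Gi i x"
proof (cases "i \<le> j")
  case True
  then show ?thesis
    using assms(1)
  proof (induction j rule: int_ge_induct)
    case (step j)
    then have "Gi j x \<le> Gi i x" using a_less_Suc(1)[of j] by simp
    then show ?case using Gi_Suc_le[OF step.prems] by simp
  qed simp
next
  case False
  then have "j \<le> i" by simp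
  then show ?thesis
  proof (induction i rule: int_ge_induct)
    case (step i)
    then have "x < a i + T" using assms(2) a_mono[of j i] by simp
    then show ?case using Gi_le_Suc[of x i] step by simp
  qed simp
qed

lemma strip_exists: "\<exists>i. a i \<le> x \<and> x < a (i + 1)"
proof -
  have up: "a 0 + int m \<le> a (int m)" for m
  proof (induction m)
    case (Suc m)
    then show ?case using a_less_Suc(1)[of "int m"] by (simp add: add.commute)
  qed simp
  have dn: "a (- int m) \<le> a 0 - int m" for m
  proof (induction m)
    case (Suc m)
    then show ?case using a_less_Suc(1)[of "- int (Suc m)"] by simp
  qed simp
  define S where "S = {i. a i \<le> x}"
  have "a 0 - int (nat (a 0 - x)) \<le> x" by simp
  then have ne: "- int (nat (a 0 - x)) \<in> S"
    using dn[of "nat (a 0 - x)"] unfolding S_def mem_Collect_eq by linarith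
  have bd: "i < int (nat (x - a 0 + 1))" if "i \<in> S" for i
  proof (rule ccontr)
    assume "\<not> i < int (nat (x - a 0 + 1))"
    then have "a (int (nat (x - a 0 + 1))) \<le> a i" by (intro a_mono) simp
    moreover have "x < a 0 + int (nat (x - a 0 + 1))" by simp
    ultimately show False
      using that up[of "nat (x - a 0 + 1)"] unfolding S_def mem_Collect_eq by linarith
  qed
  \<comment> \<open>Cutting \<open>S\<close> off below makes it finite, so that the last strip
    starting at or before \<open>x\<close> exists.\<close>
  define F where "F = S \<inter> {- int (nat (a 0 - x))..}"
  have "F \<subseteq> {- int (nat (a 0 - x))..int (nat (x - a 0 + 1))}" using bd by (force simp: F_def)
  then have fin: "finite F" using finite_subset by blast
  have "F \<noteq> {}" using ne by (auto simp: F_def)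
  then have M: "Max F \<in> F" using fin by simp
  have "Max F + 1 \<notin> F" using fin Max_ge[of F "Max F + 1"] by auto
  then have "Max F + 1 \<notin> S" using M by (auto simp: F_def)
  then show ?thesis using M by (auto simp: F_def S_def not_le)
qed

text \<open>The choice is harmless: by \<open>Gi_min\<close> in both directions, all strips
  containing \<open>x\<close> give the same value.\<close>

definition G :: "int \<Rightarrow> int" where
  "G x = Gi (SOME i. a i \<le> x \<and> x < a i + T) x"

lemma G_eq:
  assumes "a i \<le> x" "x < a i + T"
  shows "G x = Gi i x"
proof -
  let ?i = "SOME i. a i \<le> x \<and> x < a i + T"
  have "a ?i \<le> x \<and> x < a ?i + T"
    by (rule someI[of _ i]) (use assms in simp)
  then show ?thesis
    unfolding G_def using assms Gi_min[of i x ?i] Gi_min[of ?i x i] by simp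
qed

lemma strip_obtain:
  obtains i where "a i \<le> x" "x < a i + T"
  using strip_exists[of x] a_less_Suc(2) order.strict_trans2 by metis

lemma G_le_Gi: "G x \<le> Gi i x"
  by (metis strip_obtain G_eq Gi_min)

text \<open>The sweep slope of a strip containing \<open>x\<close> works. A point on or below the
  sweep line has no larger count in any column, so a time that is not earlier forces equality in the
  column of \<open>x\<close>; this puts the point on the line, against irrationality.\<close>

theorem exposed_G: "exposed T G"
  unfolding exposed_def
proof
  fix x
  obtain i where i: "a i \<le> x" "x < a i + T" by (rule strip_obtain)
  have "\<sigma> i * of_int (x' - x) < of_int y" if G: "G x \<le> T * y + G x'" and ne: "x' \<noteq> x \<or> y \<noteq> 0" for x' y
  proof (rule ccontr)
    assume "\<not> ?thesis"
    then have le: "of_int y \<le> \<sigma> i * of_int (x' - x)" by simp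
    let ?f = "\<lambda>j. y + \<lfloor>\<sigma> i * of_int (a i + j - x')\<rfloor>" and ?g = "\<lambda>j. \<lfloor>\<sigma> i * of_int (a i + j - x)\<rfloor>"
    have fg: "?f j \<le> ?g j" for j
    proof -
      have "of_int y + \<sigma> i * of_int (a i + j - x') \<le> \<sigma> i * of_int (a i + j - x)"
        using le by (simp add: algebra_simps)
      then show ?thesis by (metis floor_add_int floor_mono add.commute)
    qed
    \<comment> \<open>\<open>x'\<close> may lie outside strip \<open>i\<close>; the minimum property
      still gives the needed inequality.\<close>
    have "Gi i x \<le> T * y + Gi i x'"
      using G G_eq[OF i] G_le_Gi[of x' i] by simp
    then have "sum ?g {0..<T} \<le> sum ?f {0..<T}"
      unfolding Gi_def sum.distrib sum_const_T by simp
    moreover have "sum ?f {0..<T} < sum ?g {0..<T}" if "?f (x - a i) < ?g (x - a i)"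
      using i fg that by (intro sum_strict_mono_ex1 bexI[of _ "x - a i"]) auto
    ultimately have "?f (x - a i) = ?g (x - a i)" using fg[of "x - a i"] by linarith
    then have "y + \<lfloor>\<sigma> i * of_int (x - x')\<rfloor> = 0" by simp
    then have "of_int (- y) \<le> \<sigma> i * of_int (x - x')" by linarith
    then have "\<sigma> i * of_int (x' - x) = of_int y" using le by (simp add: algebra_simps)
    then show False using ne \<sigma>_mult_neq_int[of "x' - x" i y] by (cases "x' = x") auto
  qed
  then show "\<exists>\<sigma>. \<forall>x' y. G x \<le> T * y + G x' \<and> (x' \<noteq> x \<or> y \<noteq> 0) \<longrightarrow> \<sigma> * of_int (x' - x) < real_of_int y"
    by blast
qed

section \<open>Removal times along Farey directions, and bridges\<close>

lemma div_diff: "q i * (v - p i) div p i = q i * v div p i - q i"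
  using div_shift[of i v "- 1"] by simp

text \<open>The corrections for \<open>v\<close> and \<open>v - p (i + 1)\<close> differ only if
  \<open>0 < v \<le> p (i + 1)\<close> and \<open>p (i + 1)\<close> divides
  \<open>v\<close>.\<close>

lemma floor_\<sigma>_step_right:
  assumes "\<bar>v\<bar> \<le> n" "\<bar>v - p (i + 1)\<bar> \<le> n"
  shows "\<lfloor>\<sigma> i * of_int (v - p (i + 1))\<rfloor> + q (i + 1) = \<lfloor>\<sigma> i * of_int v\<rfloor> + of_bool (v = p (i + 1))"
proof -
  have "p (i + 1) dvd v \<longleftrightarrow> v = p (i + 1)" if "0 < v" "v \<le> p (i + 1)"
    using that zdvd_imp_le[of "p (i + 1)" v] by auto
  moreover have "p (i + 1) dvd v - p (i + 1) \<longleftrightarrow> p (i + 1) dvd v"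
    by (metis diff_add_cancel dvd_add_left_iff dvd_refl)
  ultimately show ?thesis
    unfolding floor_\<sigma>_right[OF assms(1)] floor_\<sigma>_right[OF assms(2)] div_pred div_diff
    using p_pos[of "i + 1"] by auto
qed

lemma floor_\<sigma>_step_left:
  assumes "\<bar>v\<bar> \<le> n" "\<bar>v - p i\<bar> \<le> n"
  shows "\<lfloor>\<sigma> i * of_int (v - p i)\<rfloor> + q i = \<lfloor>\<sigma> i * of_int v\<rfloor> - of_bool (v = 0)"
proof -
  have "p i dvd v \<longleftrightarrow> v = 0" if "0 \<le> v" "v < p i"
    using that zdvd_imp_le[of "p i" v] by (cases "v = 0") auto
  moreover have "p i dvd v - p i \<longleftrightarrow> p i dvd v"
    by (metis diff_add_cancel dvd_add_left_iff dvd_refl)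
  ultimately show ?thesis
    unfolding floor_\<sigma>_left[OF assms(1)] floor_\<sigma>_left[OF assms(2)] div_pred div_diff
    using p_pos[of i] by auto
qed

lemma sum_of_bool_eq: "0 \<le> m \<Longrightarrow> m < T \<Longrightarrow> (\<Sum>j\<in>{0..<T}. of_bool (j = m)) = (1::int)"
  by (simp add: of_bool_def)

text \<open>This step is steeper than the sweep line, and the only lattice point of the strip that
  it adds to the count is its end point.\<close>

lemma Gi_step_right:
  assumes "a i \<le> x" "x + p (i + 1) < a i + T"
  shows "Gi i (x + p (i + 1)) + T * q (i + 1) = Gi i x + 1"
proof -
  let ?p = "p (i + 1)" and ?q = "q (i + 1)"
  have "\<lfloor>\<sigma> i * of_int (a i + j - (x + ?p))\<rfloor> + ?q = \<lfloor>\<sigma> i * of_int (a i + j - x)\<rfloor> + of_bool (j = x + ?p - a i)"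
    if "j \<in> {0..<T}" for j
  proof -
    have "\<bar>a i + j - x\<bar> \<le> n" "\<bar>a i + j - x - ?p\<bar> \<le> n"
      using assms that T_le p_pos[of "i + 1"] by auto
    from floor_\<sigma>_step_right[OF this] show ?thesis by (simp add: algebra_simps)
  qed
  then have "(\<Sum>j\<in>{0..<T}. \<lfloor>\<sigma> i * of_int (a i + j - (x + ?p))\<rfloor> + ?q) =
      (\<Sum>j\<in>{0..<T}. \<lfloor>\<sigma> i * of_int (a i + j - x)\<rfloor> + of_bool (j = x + ?p - a i))"
    by (rule sum.cong[OF refl])
  then show ?thesis
    using assms p_pos[of "i + 1"] unfolding Gi_def sum.distrib sum_const_T by (simp add: sum_of_bool_eq)
qed

text \<open>This step is flatter than the sweep line, and the only lattice point of the strip that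
  it loses is its starting point.\<close>

lemma Gi_step_left:
  assumes "a i \<le> x" "x + p i < a i + T"
  shows "Gi i (x + p i) + T * q i = Gi i x - 1"
proof -
  have "\<lfloor>\<sigma> i * of_int (a i + j - (x + p i))\<rfloor> + q i = \<lfloor>\<sigma> i * of_int (a i + j - x)\<rfloor> - of_bool (j = x - a i)"
    if "j \<in> {0..<T}" for j
  proof -
    have "\<bar>a i + j - x\<bar> \<le> n" "\<bar>a i + j - x - p i\<bar> \<le> n"
      using assms that T_le p_pos[of i] by auto
    from floor_\<sigma>_step_left[OF this] show ?thesis by (simp add: algebra_simps)
  qed
  then have "(\<Sum>j\<in>{0..<T}. \<lfloor>\<sigma> i * of_int (a i + j - (x + p i))\<rfloor> + q i) =
      (\<Sum>j\<in>{0..<T}. \<lfloor>\<sigma> i * of_int (a i + j - x)\<rfloor> - of_bool (j = x - a i))"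
    by (rule sum.cong[OF refl])
  then show ?thesis
    using assms p_pos[of i] unfolding Gi_def sum.distrib sum_subtractf sum_const_T by (simp add: sum_of_bool_eq)
qed

text \<open>The offsets are too small for a correction to occur in either strip, so the terms agree
  one by one.\<close>

lemma Gi_step_across:
  assumes "a i \<le> x" "x < a (i + 1)" "a i + T \<le> x + p (i + 1)" "x + p (i + 1) < a (i + 1) + T"
  shows "Gi (i + 1) (x + p (i + 1)) + T * q (i + 1) = Gi i x"
proof -
  let ?p = "p (i + 1)" and ?q = "q (i + 1)" and ?k = "k (i + 1)"
  have "\<lfloor>\<sigma> (i + 1) * of_int (a i + j - (x + ?p) + ?k * ?p)\<rfloor> - ?k * ?q + ?q = \<lfloor>\<sigma> i * of_int (a i + j - x)\<rfloor>"
    if "j \<in> {0..<T}" for j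
  proof -
    define v where "v = a i + j - x"
    have v: "\<bar>v\<bar> \<le> n" "v < ?p" "\<bar>v - ?p + ?k * ?p\<bar> \<le> n" "- ?p < v - ?p + ?k * ?p"
      using assms that T_le p_pos[of "i + 1"] a_less_Suc[of i] by (auto simp: v_def a_Suc)
    have "\<not> (0 < v \<and> ?p dvd v)" using v zdvd_imp_le[of ?p v] by auto
    then have 1: "\<lfloor>\<sigma> i * of_int v\<rfloor> = ?q * v div ?p"
      unfolding floor_\<sigma>_right[OF v(1)] div_pred by auto
    have "\<not> (v - ?p + ?k * ?p < 0 \<and> ?p dvd v - ?p + ?k * ?p)"
      using v dvd_abs_less_imp_zero[of ?p "v - ?p + ?k * ?p"] by auto
    then have "\<lfloor>\<sigma> (i + 1) * of_int (v - ?p + ?k * ?p)\<rfloor> = ?q * (v - ?p + ?k * ?p) div ?p"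
      unfolding floor_\<sigma>_left[OF v(3)] div_pred by auto
    also have "\<dots> = ?q * v div ?p - ?q + ?k * ?q"
      by (simp only: div_shift div_diff)
    finally show ?thesis using 1 by (simp add: v_def algebra_simps)
  qed
  then have "(\<Sum>j\<in>{0..<T}. \<lfloor>\<sigma> (i + 1) * of_int (a i + j - (x + ?p) + ?k * ?p)\<rfloor> - ?k * ?q + ?q) =
      (\<Sum>j\<in>{0..<T}. \<lfloor>\<sigma> i * of_int (a i + j - x)\<rfloor>)"
    by (rule sum.cong[OF refl])
  then show ?thesis
    unfolding Gi_Suc unfolding Gi_def sum.distrib sum_const_T by simp
qed

text \<open>Along a lattice line of direction \<open>(p (i + 1), q (i + 1))\<close> that meets the two strips adjacent to this
  slope, the removal times rise by 1 from point to point up to the middle and then fall by 1.\<close>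

lemma G_step:
  assumes "a i \<le> x" "x + p (i + 1) < a (i + 1) + T"
  shows "\<bar>G (x + p (i + 1)) + T * q (i + 1) - G x\<bar> \<le> 1"
proof -
  let ?p = "p (i + 1)"
  have p: "1 \<le> ?p" by (rule p_pos)
  consider "x + ?p < a i + T" | "a (i + 1) \<le> x" | "x < a (i + 1)" "a i + T \<le> x + ?p" by linarith
  then show ?thesis
  proof cases
    case 1
    then have "G x = Gi i x" "G (x + ?p) = Gi i (x + ?p)" using assms p by (auto intro: G_eq)
    then show ?thesis using Gi_step_right[OF assms(1) 1] by simp
  next
    case 2
    then have "G x = Gi (i + 1) x" "G (x + ?p) = Gi (i + 1) (x + ?p)" using assms p by (auto intro: G_eq)
    then show ?thesis using Gi_step_left[OF 2 assms(2)] by simp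
  next
    case 3
    then have "G x = Gi i x" "G (x + ?p) = Gi (i + 1) (x + ?p)"
      using assms a_less_Suc(2)[of i] by (auto intro: G_eq)
    then show ?thesis using Gi_step_across[OF assms(1) 3 assms(2)] by simp
  qed
qed

text \<open>The flatter direction of strip \<open>i\<close> is followed beyond its end. Measured
  with the slope between the two strips, it deviates by the determinant 1 of Farey neighbours, and
  this makes the count drop by one.\<close>

lemma Gi_neighbour_right:
  assumes x: "a i \<le> x" "x < a i + p (i + 1)" "x + p i < a (i + 1) + p (i + 1)" "a i + T \<le> x + p i"
  shows "Gi (i + 1) (x + p i) + T * q i = Gi i x - 1"
proof -
  let ?p' = "p (i + 1)" and ?q' = "q (i + 1)" and ?k = "k (i + 1)"
  have "\<lfloor>\<sigma> (i + 1) * of_int (a i + j - (x + p i) + ?k * ?p')\<rfloor> - ?k * ?q' + q i =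
      \<lfloor>\<sigma> i * of_int (a i + j - x)\<rfloor> - of_bool (j = x - a i)"
    if "j \<in> {0..<T}" for j
  proof -
    define v where "v = a i + j - x"
    define v' where "v' = v - p i + ?k * ?p'"
    have v: "\<bar>v\<bar> \<le> n" "- ?p' < v" "\<bar>v'\<bar> \<le> n" "- ?p' < v'"
      using x that T_le p_pos[of "i + 1"] p_le[of "i + 1"] a_less_Suc[of i] by (auto simp: v_def v'_def a_Suc)
    have "\<not> (v' < 0 \<and> ?p' dvd v')" using v dvd_abs_less_imp_zero[of ?p' v'] by auto
    then have "\<lfloor>\<sigma> (i + 1) * of_int v'\<rfloor> = ?q' * v' div ?p'"
      unfolding floor_\<sigma>_left[OF v(3)] div_pred by auto
    also have "?q' * v' = ?q' * v - 1 + (?k * ?q' - q i) * ?p'"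
      using farey_neighbours[of i] by (simp add: v'_def algebra_simps)
    also have "\<dots> div ?p' = (?q' * v - 1) div ?p' + (?k * ?q' - q i)"
      using p_pos[of "i + 1"] by simp
    finally have "\<lfloor>\<sigma> (i + 1) * of_int v'\<rfloor> - ?k * ?q' + q i = ?q' * v div ?p' - of_bool (?p' dvd v)"
      by (simp add: div_pred)
    moreover have "\<lfloor>\<sigma> i * of_int v\<rfloor> = ?q' * v div ?p' - of_bool (0 < v \<and> ?p' dvd v)"
      unfolding floor_\<sigma>_right[OF v(1)] div_pred by auto
    moreover have "v \<le> 0 \<and> ?p' dvd v \<longleftrightarrow> v = 0" using v dvd_abs_less_imp_zero[of ?p' v] by auto
    ultimately have "\<lfloor>\<sigma> (i + 1) * of_int v'\<rfloor> - ?k * ?q' + q i = \<lfloor>\<sigma> i * of_int v\<rfloor> - of_bool (v = 0)"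
      by (cases "0 < v") auto
    then show ?thesis by (simp add: v_def v'_def algebra_simps)
  qed
  then have "(\<Sum>j\<in>{0..<T}. \<lfloor>\<sigma> (i + 1) * of_int (a i + j - (x + p i) + ?k * ?p')\<rfloor> - ?k * ?q' + q i) =
      (\<Sum>j\<in>{0..<T}. \<lfloor>\<sigma> i * of_int (a i + j - x)\<rfloor> - of_bool (j = x - a i))"
    by (rule sum.cong[OF refl])
  moreover have "x - a i < T" using x p_le[of "i + 1"] n_le by simp
  ultimately show ?thesis
    using x unfolding Gi_Suc unfolding Gi_def sum.distrib sum_subtractf sum_const_T by (simp add: sum_of_bool_eq)
qed

text \<open>The mirror image: the steeper direction of strip \<open>i + 1\<close> is followed
  backwards into strip \<open>i\<close>.\<close>

lemma Gi_neighbour_left: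
  assumes x: "x < a (i + 1) + T" "a (i + 1) + T \<le> x + p (i + 1)"
    "a i + T \<le> x - p (i + 2) + p (i + 1)" "x - p (i + 2) < a (i + 1)"
  shows "Gi i (x - p (i + 2)) - T * q (i + 2) = Gi (i + 1) x - 1"
proof -
  let ?p = "p (i + 1)" and ?q = "q (i + 1)" and ?k = "k (i + 1)" and ?p' = "p (i + 2)" and ?q' = "q (i + 2)"
  have "\<lfloor>\<sigma> i * of_int (a i + j - (x - ?p'))\<rfloor> - ?q' =
      \<lfloor>\<sigma> (i + 1) * of_int (a i + j - x + ?k * ?p)\<rfloor> - ?k * ?q - of_bool (j = x - a (i + 1))"
    if "j \<in> {0..<T}" for j
  proof -
    define v where "v = a i + j - x + ?k * ?p"
    define v' where "v' = a i + j - (x - ?p')"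
    have v: "\<bar>v\<bar> \<le> n" "v < ?p" "\<bar>v'\<bar> \<le> n" "v' < ?p"
      using x that T_le p_pos[of "i + 1"] p_le[of "i + 1"] a_less_Suc[of i] by (auto simp: v_def v'_def a_Suc)
    have v'_eq: "v' = v + ?p' - ?k * ?p" by (simp add: v_def v'_def)
    have "\<not> (0 < v' \<and> ?p dvd v')" using v dvd_abs_less_imp_zero[of ?p v'] by auto
    then have "\<lfloor>\<sigma> i * of_int v'\<rfloor> = ?q * v' div ?p"
      unfolding floor_\<sigma>_right[OF v(3)] div_pred by auto
    also have "?q * v' = ?q * v - 1 + (?q' - ?k * ?q) * ?p"
      using farey_neighbours[of "i + 1"] by (simp add: v'_eq algebra_simps)
    also have "\<dots> div ?p = (?q * v - 1) div ?p + (?q' - ?k * ?q)"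
      using p_pos[of "i + 1"] by simp
    finally have "\<lfloor>\<sigma> i * of_int v'\<rfloor> - ?q' = ?q * v div ?p - of_bool (?p dvd v) - ?k * ?q"
      by (simp add: div_pred)
    moreover have "\<lfloor>\<sigma> (i + 1) * of_int v\<rfloor> = ?q * v div ?p - of_bool (v < 0 \<and> ?p dvd v)"
      unfolding floor_\<sigma>_left[OF v(1)] div_pred by auto
    moreover have "0 \<le> v \<and> ?p dvd v \<longleftrightarrow> v = 0" using v dvd_abs_less_imp_zero[of ?p v] by auto
    ultimately have "\<lfloor>\<sigma> i * of_int v'\<rfloor> - ?q' = \<lfloor>\<sigma> (i + 1) * of_int v\<rfloor> - ?k * ?q - of_bool (v = 0)"
      by (cases "v < 0") auto
    moreover have "v = 0 \<longleftrightarrow> j = x - a (i + 1)" by (auto simp: v_def a_Suc)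
    ultimately show ?thesis by (simp add: v_def v'_def)
  qed
  then have "(\<Sum>j\<in>{0..<T}. \<lfloor>\<sigma> i * of_int (a i + j - (x - ?p'))\<rfloor> - ?q') =
      (\<Sum>j\<in>{0..<T}. \<lfloor>\<sigma> (i + 1) * of_int (a i + j - x + ?k * ?p)\<rfloor> - ?k * ?q - of_bool (j = x - a (i + 1)))"
    by (rule sum.cong[OF refl])
  moreover have "0 \<le> x - a (i + 1)" using x p_le[of "i + 1"] n_le by simp
  ultimately show ?thesis
    using x unfolding Gi_Suc unfolding Gi_def sum_subtractf sum_const_T by (simp add: sum_of_bool_eq)
qed

theorem bridged_G:
  assumes n: "n = T - 1"
  shows "bridged T G"
  unfolding bridged_def
proof
  fix x
  let ?goal = "\<exists>p q. (p, q) \<noteq> (0, 0) \<and> G x - 1 \<le> T * q + G (x + p) \<and> G x - 1 \<le> G (x - p) - T * q"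
  have goalI: ?goal if "1 \<le> P" "G x - 1 \<le> G (x + P) + T * Q" "G x - 1 \<le> G (x - P) - T * Q" for P Q
    using that by (intro exI[of _ P] exI[of _ Q]) auto
  obtain i0 where "a i0 \<le> x" "x < a (i0 + 1)" using strip_exists by blast
  \<comment> \<open>The strip of \<open>x\<close> becomes number \<open>i + 1\<close>, lying between
    the slopes \<open>i + 1\<close> and \<open>i + 2\<close>, so that the previous strip has index
    \<open>i\<close>.\<close>
  define i where "i = i0 - 1"
  have i0: "i0 = i + 1" "i0 + 1 = i + 2" by (simp_all add: i_def)
  have x: "a (i + 1) \<le> x" "x < a (i + 1) + T"
    using \<open>a i0 \<le> x\<close> \<open>x < a (i0 + 1)\<close> a_less_Suc(2)[of i0] by (simp_all add: i0)
  let ?p = "p (i + 1)" and ?q = "q (i + 1)" and ?p' = "p (i + 2)" and ?q' = "q (i + 2)"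
  have eq2: "i + 1 + 1 = i + 2" by simp
  have p: "1 \<le> ?p" "1 \<le> ?p'" "?p < T" "?p' < T"
    using p_pos p_le[of "i + 1"] p_le[of "i + 2"] n by auto
  have a1: "a i + ?p \<le> a (i + 1)" "a (i + 1) < a i + T"
    using k_bounds(2,4)[of "i + 1"] n by (simp_all add: a_Suc)
  have a2: "a (i + 1) + ?p' \<le> a (i + 2)" "a (i + 2) < a (i + 1) + T" "a (i + 1) + T \<le> a (i + 2) + ?p'"
    using k_bounds(2,4,5)[of "i + 2"] n a_Suc[of "i + 1"] by (simp_all add: eq2)
  note step = G_step[of i] and step' = G_step[of "i + 1", unfolded eq2]
  \<comment> \<open>Away from the left end of the strip the upper slope gives a bridge, away from
    the right end the lower one. Near both ends the direction with the smaller denominator is taken;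
    one of its ends is controlled by the determinant.\<close>
  consider "a (i + 1) + ?p' \<le> x" | "x + ?p < a (i + 1) + T"
    | "x < a (i + 1) + ?p'" "a (i + 1) + T \<le> x + ?p" "?p \<le> ?p'"
    | "x < a (i + 1) + ?p'" "a (i + 1) + T \<le> x + ?p" "?p' < ?p" by linarith
  then show ?goal
  proof cases
    case 1
    show ?thesis
      using step'[of x] step'[of "x - ?p'"] 1 x p a2 by (intro goalI[of ?p' ?q']) auto
  next
    case 2
    show ?thesis
      using step[of x] step[of "x - ?p"] 2 x p a1 by (intro goalI[of ?p ?q]) auto
  next
    case 3
    have "G (x + ?p) = Gi (i + 2) (x + ?p)" "G x = Gi (i + 1) x"
      using 3 x p a2 by (auto intro!: G_eq)
    moreover have "Gi (i + 2) (x + ?p) + T * ?q = Gi (i + 1) x - 1"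
      using Gi_neighbour_right[of "i + 1" x] 3 x p a2 by (simp add: eq2)
    ultimately show ?thesis
      using step[of "x - ?p"] 3 x p a1 by (intro goalI[of ?p ?q]) auto
  next
    case 4
    have "G (x - ?p') = Gi i (x - ?p')" "G x = Gi (i + 1) x"
      using 4 x p a1 by (auto intro!: G_eq)
    moreover have "Gi i (x - ?p') - T * ?q' = Gi (i + 1) x - 1"
      using 4 x p a1 by (intro Gi_neighbour_left) auto
    ultimately show ?thesis
      using step'[of x] 4 x p a2 by (intro goalI[of ?p' ?q']) auto
  qed
qed

end

section \<open>Periodicity and distance from a parabola\<close>

lemma int_step_const:
  fixes D :: "int \<Rightarrow> 'a"
  assumes "\<And>i. D (i + 1) = D i"
  shows "D i = D 0"
proof (induction i rule: int_induct[where k = 0])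
  case (step2 i)
  then show ?case using assms[of "i - 1"] by simp
qed (simp_all add: assms)

lemma antidifference_exists:
  fixes f :: "int \<Rightarrow> int"
  shows "\<exists>c. \<forall>i. c (i + 1) = c i + f i"
proof -
  define c where "c = (\<lambda>i. if 0 \<le> i then sum f {0..<i} else - sum f {i..<0})"
  have "c (i + 1) = c i + f i" for i
  proof -
    consider "0 \<le> i" | "i = - 1" | "i < - 1" by linarith
    then show ?thesis
    proof cases
      case 1
      then have "{0..<i + 1} = insert i {0..<i}" by auto
      then show ?thesis using 1 by (simp add: c_def)
    next
      case 2
      then have "{i..<0} = {i}" by auto
      then show ?thesis using 2 by (simp add: c_def)
    next
      case 3
      then have "{i..<0} = insert i {i + 1..<0}" by auto
      then show ?thesis using 3 by (simp add: c_def)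
    qed
  qed
  then show ?thesis by blast
qed

text \<open>Over \<open>r\<close> indices the slope grows by 1 while the strips advance by
  \<open>h\<close> columns, hence the mean curvature \<open>1 / h\<close>.\<close>

locale periodic_strips = strips +
  fixes r h :: int
  assumes h_pos: "1 \<le> h"
    and p_shift: "p (i + r) = p i" and q_shift: "q (i + r) = q i + p i" and a_shift: "a (i + r) = a i + h"
begin

lemma \<sigma>_shift: "\<sigma> (i + r) = \<sigma> i + 1"
proof -
  have *: "slope (i + r) = slope i + 1" for i
    using p_pos[of i] by (simp add: slope_def p_shift q_shift add_divide_distrib)
  have "slope (i + r + 1) = slope (i + 1) + 1" using *[of "i + 1"] by (simp add: ac_simps)
  then show ?thesis by (simp add: \<sigma>_def *)
qed

lemma G_shift: "\<exists>D. \<forall>x. G (x + h) = G x - T * x + D"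
proof -
  \<comment> \<open>A priori the constant depends on the strip; the recursions for \<open>a\<close>
    and \<open>c\<close> show that it does not.\<close>
  define D where "D i = c (i + r) - c i + (\<Sum>j\<in>{0..<T}. a i + j)" for i
  have D_step: "D (i + 1) = D i" for i
  proof -
    have "c (i + 1 + r) = c (i + r) - T * (k (i + 1) * (q (i + 1) + p (i + 1)))"
      using c_Suc[of "i + r"] p_shift[of "i + 1"] q_shift[of "i + 1"] by (simp add: ac_simps)
    then show ?thesis
      unfolding D_def c_Suc a_Suc sum.distrib sum_const_T by (simp add: algebra_simps)
  qed
  have D0: "D i = D 0" for i by (rule int_step_const[of D]) (rule D_step)
  have Gi: "Gi (i + r) (x + h) = Gi i x - T * x + D 0" for i x
  proof -
    have "\<lfloor>\<sigma> (i + r) * of_int (a (i + r) + j - (x + h))\<rfloor> = \<lfloor>\<sigma> i * of_int (a i + j - x)\<rfloor> + ((a i + j) - x)" for j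
    proof -
      have "\<sigma> (i + r) * of_int (a (i + r) + j - (x + h)) = \<sigma> i * of_int (a i + j - x) + of_int (a i + j - x)"
        by (simp add: \<sigma>_shift a_shift algebra_simps)
      then show ?thesis by (simp only: floor_add_int)
    qed
    then have "Gi (i + r) (x + h) = c (i + r) + (\<Sum>j\<in>{0..<T}. \<lfloor>\<sigma> i * of_int (a i + j - x)\<rfloor> + ((a i + j) - x))"
      by (simp only: Gi_def)
    also have "\<dots> = Gi i x - T * x + D i"
      unfolding Gi_def D_def sum.distrib sum_subtractf sum_const_T by simp
    finally show ?thesis using D0 by simp
  qed
  have "G (x + h) = G x - T * x + D 0" for x
  proof -
    obtain i where i: "a i \<le> x" "x < a i + T" by (rule strip_obtain)
    then have "G (x + h) = Gi (i + r) (x + h)" by (intro G_eq) (auto simp: a_shift)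
    then show ?thesis using Gi G_eq[OF i] by simp
  qed
  then show ?thesis by blast
qed

theorem near_parabola_G: "near_parabola T G (1 / of_int h)"
proof -
  obtain D where D: "\<And>x. G (x + h) = G x - T * x + D" using G_shift by blast
  \<comment> \<open>This linear coefficient cancels the constant increments, making the deviation
    \<open>E\<close> periodic with period \<open>h\<close> and therefore bounded.\<close>
  define \<beta> where "\<beta> = - (of_int D / of_int T + of_int h / 2) / (of_int h :: real)"
  define E where "E x = of_int (G x) / of_int T + (1 / of_int h / 2 * (of_int x)\<^sup>2 + \<beta> * of_int x)" for x
  have h: "0 < real_of_int h" and T: "0 < real_of_int T" using h_pos T_pos by auto
  have E: "E (x + h) = E x" for x
  proof -
    have \<beta>: "\<beta> * of_int h = - (of_int D / of_int T + of_int h / 2)" using h by (simp add: \<beta>_def)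
    have G: "of_int (G (x + h)) / of_int T = of_int (G x) / of_int T - of_int x + of_int D / (of_int T :: real)"
      using T by (simp add: D add_divide_distrib diff_divide_distrib)
    have sq: "1 / of_int h / 2 * (of_int (x + h))\<^sup>2 = 1 / of_int h / 2 * (of_int x)\<^sup>2 + of_int x + of_int h / (2 :: real)"
      using h by (simp add: power2_eq_square field_simps)
    show ?thesis unfolding E_def G sq by (simp add: distrib_left \<beta>)
  qed
  have E_mod: "E (x + m * h) = E x" for x m
    using int_step_const[of "\<lambda>m. E (x + m * h)" m] E by (simp add: distrib_right flip: add.assoc)
  have "\<bar>E x\<bar> \<le> Max ((\<lambda>x. \<bar>E x\<bar>) ` {0..<h})" for x
  proof -
    have "E x = E (x mod h)" using E_mod[of "x mod h" "x div h"] by simp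
    then have "\<bar>E x\<bar> \<in> (\<lambda>x. \<bar>E x\<bar>) ` {0..<h}" using h_pos by auto
    then show ?thesis by (intro Max_ge) auto
  qed
  then show ?thesis
    unfolding near_parabola_def E_def by blast
qed

end

subsection \<open>The Farey slopes\<close>

text \<open>The pair \<open>(x, y)\<close> stands for the reduced fraction \<open>y / x\<close> in
  the interval from 0 (excluded) to 1 (included).\<close>

definition farey_pairs :: "nat \<Rightarrow> (nat \<times> nat) set" where
  "farey_pairs N = {(x, y). 1 \<le> y \<and> y \<le> x \<and> x \<le> N \<and> gcd x y = 1}"

lemma finite_farey_pairs: "finite (farey_pairs N)"
  by (rule finite_subset[of _ "{..N} \<times> {..N}"]) (auto simp: farey_pairs_def)

lemma H_eq: "H N = (\<Sum>(x, y)\<in>farey_pairs N. N div x * x)"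
  by (simp add: H_def farey_pairs_def)

lemma H_less_Suc: "1 \<le> N \<Longrightarrow> H N < H (Suc N)"
proof -
  assume N: "1 \<le> N"
  have "H N < (\<Sum>(x, y)\<in>farey_pairs N. Suc N div x * x)"
    unfolding H_eq
  proof (rule sum_strict_mono_ex1)
    show "\<forall>z\<in>farey_pairs N. (case z of (x, y) \<Rightarrow> N div x * x) \<le> (case z of (x, y) \<Rightarrow> Suc N div x * x)"
      by (auto intro!: mult_right_mono div_le_mono)
    show "\<exists>z\<in>farey_pairs N. (case z of (x, y) \<Rightarrow> N div x * x) < (case z of (x, y) \<Rightarrow> Suc N div x * x)"
      using N by (intro bexI[of _ "(1, 1)"]) (auto simp: farey_pairs_def)
  qed (rule finite_farey_pairs)
  also have "\<dots> \<le> H (Suc N)"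
    unfolding H_eq by (intro sum_mono2 finite_farey_pairs) (auto simp: farey_pairs_def)
  finally show ?thesis .
qed

lemma H_pos: "1 \<le> N \<Longrightarrow> 0 < H N"
proof (induction N rule: nat_induct_at_least)
  case base
  have "farey_pairs 1 = {(1, 1)}" by (auto simp: farey_pairs_def)
  then show ?case by (simp add: H_eq)
next
  case (Suc N)
  then show ?case using H_less_Suc[of N] by simp
qed

lemma inj_on_farey_ratio: "inj_on (\<lambda>(x, y). real y / real x) (farey_pairs N)"
proof (rule inj_onI, clarify)
  fix x y x' y' assume z: "(x, y) \<in> farey_pairs N" "(x', y') \<in> farey_pairs N" "real y / real x = real y' / real x'"
  then have "real (y * x') = real (y' * x)" by (auto simp: farey_pairs_def field_simps)
  then have eq: "y * x' = y' * x" by (simp only: of_nat_eq_iff)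
  have "coprime x y" "coprime x' y'" using z by (auto simp: farey_pairs_def coprime_iff_gcd_eq_1)
  have "x dvd x'" using eq \<open>coprime x y\<close> by (metis coprime_dvd_mult_right_iff dvd_triv_right)
  moreover have "x' dvd x" using eq \<open>coprime x' y'\<close> by (metis coprime_dvd_mult_right_iff dvd_triv_right)
  ultimately have "x = x'" by (rule dvd_antisym)
  then show "x = x' \<and> y = y'" using eq z by (auto simp: farey_pairs_def)
qed

lemma farey_ratio_cover:
  assumes "0 < w" "w \<le> v" "v \<le> int N"
  shows "\<exists>(x, y)\<in>farey_pairs N. real y / real x = of_int w / of_int v"
proof -
  define g where "g = gcd v w"
  have g: "0 < g" using assms by (simp add: g_def)
  obtain x y where xy: "v = x * g" "w = y * g" "coprime x y"
    using gcd_coprime_exists[of v w] g unfolding g_def by auto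
  have pos: "0 < x" "0 < y" "y \<le> x" using xy assms g by (simp_all add: zero_less_mult_iff)
  have "x * 1 \<le> x * g" using pos g by (intro mult_left_mono) auto
  then have "x \<le> int N" using xy assms by simp
  moreover have "int (gcd (nat x) (nat y)) = gcd x y" using pos by (simp flip: gcd_int_int_eq)
  then have "gcd (nat x) (nat y) = 1" using xy(3) by (simp add: coprime_iff_gcd_eq_1)
  ultimately have "(nat x, nat y) \<in> farey_pairs N"
    using pos by (auto simp: farey_pairs_def nat_le_iff)
  moreover have "real (nat y) / real (nat x) = of_int w / of_int v"
  proof -
    have "real_of_int w / real_of_int v = of_int y / of_int x"
      using g unfolding xy(1,2) of_int_mult by simp
    then show ?thesis using pos by simp
  qed
  ultimately show ?thesis by (intro bexI[of _ "(nat x, nat y)"]) simp_all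
qed

text \<open>The sorted fractions of one unit interval, repeated under integer translation, form the
  slope sequence; the strip shifts of one period add up to \<open>H N\<close>.\<close>

lemma front_exists:
  fixes N :: nat and T :: int
  assumes N: "1 \<le> N" and T: "T - 1 \<le> int N" "int N \<le> T"
  shows "\<exists>G. exposed T G \<and> (int N = T - 1 \<longrightarrow> bridged T G) \<and> near_parabola T G (1 / real (H N))"
proof -
  define ratio :: "nat \<times> nat \<Rightarrow> real" where "ratio = (\<lambda>(x, y). real y / real x)"
  define l where "l = sorted_list_of_set (ratio ` farey_pairs N)"
  define R where "R = length l"
  define pr where "pr j = inv_into (farey_pairs N) ratio (l ! j)" for j
  have inj: "inj_on ratio (farey_pairs N)" unfolding ratio_def by (rule inj_on_farey_ratio)
  have set_l: "set l = ratio ` farey_pairs N" by (simp add: l_def finite_farey_pairs)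
  have l_less: "l ! i < l ! j" if "i < j" "j < R" for i j
    using that sorted_wrt_nth_less[OF strict_sorted_list_of_set, of i j "ratio ` farey_pairs N"]
    by (simp add: l_def R_def)
  have bij_l: "bij_betw (\<lambda>j. l ! j) {..<R} (ratio ` farey_pairs N)"
    using bij_betw_nth[of l "{..<R}" "set l"] unfolding set_l by (simp add: R_def l_def)
  have bij_pr: "bij_betw pr {..<R} (farey_pairs N)"
    unfolding pr_def by (rule bij_betw_trans[OF bij_l bij_betw_inv_into[OF inj_on_imp_bij_betw[OF inj]], unfolded comp_def])
  have pr: "pr j \<in> farey_pairs N" "ratio (pr j) = l ! j" if "j < R" for j
  proof -
    have "l ! j \<in> ratio ` farey_pairs N" using that set_l nth_mem[of j l] by (simp add: R_def)
    then show "pr j \<in> farey_pairs N" "ratio (pr j) = l ! j"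
      unfolding pr_def by (rule inv_into_into, rule f_inv_into_f)
  qed
  have "(1, 1) \<in> farey_pairs N" using N by (simp add: farey_pairs_def)
  then have R: "0 < R" using bij_pr by (auto simp: bij_betw_def)
  define r where "r = int R"
  have r: "0 < r" using R by (simp add: r_def)
  define idx where "idx i = nat (i mod r)" for i
  have idx: "idx i < R" for i using r pos_mod_bound[OF r, of i] pos_mod_sign[OF r, of i] 
    by (simp add: idx_def nat_less_iff flip: r_def)
  define p where "p i = int (fst (pr (idx i)))" for i
  define q where "q i = int (snd (pr (idx i))) + i div r * p i" for i
  have F: "1 \<le> snd (pr (idx i))" "snd (pr (idx i)) \<le> fst (pr (idx i))" "fst (pr (idx i)) \<le> N"
    "gcd (fst (pr (idx i))) (snd (pr (idx i))) = 1" for i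
    using pr(1)[OF idx, of i] by (auto simp: farey_pairs_def case_prod_beta)
  have p_pos: "1 \<le> p i" and p_le: "p i \<le> int N" for i using F[of i] by (auto simp: p_def)
  define sl where "sl i = of_int (q i) / (of_int (p i) :: real)" for i
  have sl_eq: "sl i = l ! idx i + of_int (i div r)" for i
    using pr(2)[OF idx, of i] p_pos[of i] by (simp add: sl_def q_def p_def ratio_def case_prod_beta add_divide_distrib)
  have l_bounds: "0 < l ! idx i" "l ! idx i \<le> 1" for i
    unfolding pr(2)[OF idx, symmetric] ratio_def case_prod_beta using F[of i] by simp_all
  have sl_less: "sl i < sl (i + 1)" for i
  proof (cases "i mod r = r - 1")
    case True
    \<comment> \<open>At the end of a period the integer part grows by 1, while fractions are
      positive and at most 1, so the order is kept.\<close>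
    then have i1: "i + 1 = r * (i div r + 1) + 0" using mult_div_mod_eq[of r i] by (simp add: distrib_left)
    have "(i + 1) div r = i div r + 1" using r by (intro int_div_pos_eq[OF i1]) auto
    then show ?thesis unfolding sl_eq using l_bounds[of i] l_bounds[of "i + 1"] by simp
  next
    case False
    have m: "0 \<le> i mod r" "i mod r + 1 < r" using False pos_mod_bound[OF r, of i] pos_mod_sign[OF r, of i] by linarith+
    have i1: "i + 1 = r * (i div r) + (i mod r + 1)" by simp
    have "(i + 1) div r = i div r" by (rule int_div_pos_eq[OF i1]) (use m in auto)
    moreover have "(i + 1) mod r = i mod r + 1" by (rule int_mod_pos_eq[OF i1]) (use m in auto)
    then have "idx (i + 1) = idx i + 1"
      using m by (simp add: idx_def nat_add_distrib)
    ultimately show ?thesis unfolding sl_eq using l_less[of "idx i" "idx (i + 1)"] idx[of "i + 1"] by simp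
  qed
  have sl_mono: "sl i \<le> sl j" if "i \<le> j" for i j
    using that by (induction j rule: int_ge_induct) (use sl_less in \<open>auto intro: order.trans less_imp_le\<close>)
  have cover: "\<exists>i. sl i = of_int u / of_int v" if "0 < v" "v \<le> int N" for u v
  proof -
    \<comment> \<open>\<open>m\<close> is the ceiling of \<open>u / v\<close> minus 1, matching a
      unit interval closed at its right end.\<close>
    define m where "m = (u - 1) div v"
    define w where "w = u - m * v"
    have "w = (u - 1) mod v + 1" using div_mult_mod_eq[of "u - 1" v] unfolding w_def m_def by linarith
    then have "0 < w" "w \<le> v" using pos_mod_sign[OF that(1), of "u - 1"] pos_mod_bound[OF that(1), of "u - 1"] by linarith+
    then have "of_int w / of_int v \<in> ratio ` farey_pairs N"
      using farey_ratio_cover[of w v N] that by (force simp: ratio_def)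
    then obtain j where j: "j < R" "l ! j = of_int w / of_int v"
      using set_l by (metis R_def in_set_conv_nth)
    have "idx (m * r + int j) = j" "(m * r + int j) div r = m" using j r by (simp_all add: idx_def r_def)
    then have "sl (m * r + int j) = of_int w / of_int v + of_int m" by (simp add: sl_eq j)
    also have "\<dots> = of_int u / of_int v" using that by (simp add: w_def field_simps)
    finally show ?thesis by blast
  qed
  obtain \<rho> :: real where \<rho>: "0 < \<rho>" "\<rho> < 1" "\<rho> \<notin> \<rat>"
  proof -
    have "uncountable {0<..<1::real}" by (simp add: uncountable_open_interval)
    then have "\<not> {0<..<1::real} \<subseteq> \<rat>" using countable_rat countable_subset by blast
    then obtain x :: real where "x \<in> {0<..<1}" "x \<notin> \<rat>" by blast
    then show thesis by (intro that[of x]) auto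
  qed
  interpret slope_sequence "int N" p q \<rho>
  proof
    fix i
    show "1 \<le> p i" "p i \<le> int N" by (rule p_pos, rule p_le)
    have "coprime (p i) (int (snd (pr (idx i))))" using F(4)[of i] by (simp add: p_def coprime_iff_gcd_eq_1)
    then show "coprime (p i) (q i)"
      unfolding q_def coprime_iff_gcd_eq_1 by (simp only: add.commute[of "int _"] gcd_add_mult)
    have "of_int (q i * p (i + 1)) < (of_int (q (i + 1) * p i) :: real)"
      using sl_less[of i] p_pos[of i] p_pos[of "i + 1"] by (simp add: sl_def field_simps)
    then show "q i * p (i + 1) < q (i + 1) * p i" by (simp only: of_int_less_iff)
  next
    fix v u i assume v: "0 < v" "v \<le> int N"
    \<comment> \<open>Every admissible fraction occurs in the monotone sequence, and no index lies
      between \<open>i\<close> and \<open>i + 1\<close>.\<close>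
    then obtain j where j: "sl j = of_int u / of_int v" using cover by blast
    have "j \<le> i \<or> i + 1 \<le> j" by linarith
    then have "of_int u / of_int v \<le> sl i \<or> sl (i + 1) \<le> of_int u / of_int v" using sl_mono j by metis
    then have "of_int (u * p i) \<le> (of_int (q i * v) :: real) \<or> of_int (q (i + 1) * v) \<le> (of_int (u * p (i + 1)) :: real)"
      using v p_pos[of i] p_pos[of "i + 1"] by (simp add: sl_def field_simps)
    then show "u * p i \<le> q i * v \<or> q (i + 1) * v \<le> u * p (i + 1)" by (simp only: of_int_le_iff)
  qed (rule \<rho>)+
  have idx_shift: "idx (i + r) = idx i" "(i + r) div r = i div r + 1" for i using r by (simp_all add: idx_def)
  have p_shift: "p (i + r) = p i" and q_shift: "q (i + r) = q i + p i" for i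
    by (simp_all add: p_def q_def idx_shift algebra_simps)
  define f where "f i = int N div p (i + 1) * p (i + 1)" for i
  obtain a where a: "\<And>i. a (i + 1) = a i + f i" using antidifference_exists[of f] by blast
  obtain c where c: "\<And>i. c (i + 1) = c i + - (T * (int N div p (i + 1) * q (i + 1)))"
    using antidifference_exists[of "\<lambda>i. - (T * (int N div p (i + 1) * q (i + 1)))"] by blast
  have a_sum: "a (int m) = a 0 + (\<Sum>j<m. f (int j))" for m
  proof (induction m)
    case (Suc m)
    then show ?case using a[of "int m"] by (simp add: ac_simps)
  qed simp
  have "a r - a 0 = (\<Sum>j<R. f (int j))" by (simp add: r_def a_sum)
  \<comment> \<open>\<open>f\<close> uses the denominators with indices 1 to \<open>R\<close>;
    periodicity replaces index \<open>R\<close> by index 0.\<close>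
  also have "\<dots> = (\<Sum>j<R. int N div p (int j) * p (int j))"
  proof -
    have "(\<Sum>j<Suc R. int N div p (int j) * p (int j)) = int N div p 0 * p 0 + (\<Sum>j<R. f (int j))"
      by (subst sum.lessThan_Suc_shift) (simp add: f_def add.commute)
    moreover have "p (int R) = p 0" using p_shift[of 0] by (simp add: r_def)
    ultimately show ?thesis by simp
  qed
  also have "\<dots> = (\<Sum>j<R. int (N div fst (pr j) * fst (pr j)))"
    by (intro sum.cong refl) (simp add: p_def idx_def r_def zdiv_int)
  also have "\<dots> = (\<Sum>z\<in>farey_pairs N. int (N div fst z * fst z))"
    by (rule sum.reindex_bij_betw[OF bij_pr])
  also have "\<dots> = int (H N)"
    unfolding H_eq by (simp add: case_prod_beta)
  finally have ar: "a r - a 0 = int (H N)" .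
  have "a (i + 1 + r) - a (i + 1) = a (i + r) - a i" for i
    using a[of i] a[of "i + r"] p_shift[of "i + 1"] by (simp add: f_def ac_simps)
  then have a_shift: "a (i + r) = a i + int (H N)" for i
    using int_step_const[of "\<lambda>i. a (i + r) - a i" i] ar by simp
  interpret periodic_strips "int N" p q \<rho> T a c r "int (H N)"
    using N T a c H_pos[OF N] p_shift q_shift a_shift by unfold_locales (simp_all add: f_def)
  show ?thesis
    using exposed_G bridged_G near_parabola_G by auto
qed

subsection \<open>Average speeds of a parabola\<close>

text \<open>Uses the front with denominators up to \<open>T\<close>, whose curvature
  \<open>1 / H T\<close> is below \<open>a\<close>.\<close>

lemma v_minus_parabola_ge:
  fixes a b c :: real and T :: nat
  assumes "1 \<le> T" "1 / real (H T) < a"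
  shows "ereal (1 / real T) \<le> v_minus (\<lambda>x. a / 2 * x\<^sup>2 + b * x + c)"
proof -
  obtain G where "exposed (int T) G" "near_parabola (int T) G (1 / real (H T))"
    using front_exists[of T "int T"] assms by auto
  then obtain C where "\<forall>m. below_peeled (\<lambda>x. a / 2 * x\<^sup>2 + b * x + c) m (real m / of_int (int T) - C)"
    using below_peeled_near_parabola[of "int T" G "1 / real (H T)" a b c] assms H_pos by auto
  then show ?thesis using v_minus_ge[of "int T"] assms by simp
qed

text \<open>Fractions with denominators up to \<open>T - 1\<close> serve for
  \<open>T > 1\<close>.\<close>

lemma bridged_front_exists:
  fixes a :: real and T :: nat
  assumes "1 \<le> T" "T = 1 \<or> a < 1 / real (H (T - 1))"
  shows "\<exists>G A. bridged (int T) G \<and> near_parabola (int T) G A \<and> a < A"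
proof (cases "T = 1")
  case True
  obtain m :: nat where m: "a < real m" using reals_Archimedean2 by blast
  \<comment> \<open>For \<open>T = 1\<close> the vertical neighbours of a point form a bridge, so
    the curvature can be taken arbitrarily large.\<close>
  have "bridged 1 (\<lambda>x. - int m * x\<^sup>2)"
    unfolding bridged_def by (intro allI exI[of _ 0] exI[of _ 1]) simp
  moreover have "near_parabola 1 (\<lambda>x. - int m * x\<^sup>2) (2 * real m)"
    unfolding near_parabola_def by (intro exI[of _ 0]) simp
  ultimately show ?thesis using True m by (intro exI[of _ "\<lambda>x. - int m * x\<^sup>2"] exI[of _ "2 * real m"]) auto
next
  case False
  then have "1 \<le> T - 1" "int (T - 1) = int T - 1" using assms by auto
  then obtain G where "bridged (int T) G" "near_parabola (int T) G (1 / real (H (T - 1)))"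
    using front_exists[of "T - 1" "int T"] by auto
  then show ?thesis using assms False by blast
qed

lemma v_plus_parabola_le:
  fixes a b c :: real and T :: nat
  assumes "0 < a" "1 \<le> T" "T = 1 \<or> a < 1 / real (H (T - 1))"
  shows "v_plus (\<lambda>x. a / 2 * x\<^sup>2 + b * x + c) \<le> ereal (1 / real T)"
proof -
  obtain G A where "bridged (int T) G" "near_parabola (int T) G A" "a < A"
    using bridged_front_exists assms by blast
  then obtain C where "\<forall>m. above_peeled (\<lambda>x. a / 2 * x\<^sup>2 + b * x + c) m (real m / of_int (int T) + C)"
    using above_peeled_near_parabola[of "int T" G A a b c] assms by auto
  then show ?thesis using v_plus_le[of "int T"] assms by simp
qed

lemma v_minus_le_v_plus_parabola:
  fixes a b c :: real
  assumes "0 < a"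
  shows "v_minus (\<lambda>x. a / 2 * x\<^sup>2 + b * x + c) \<le> v_plus (\<lambda>x. a / 2 * x\<^sup>2 + b * x + c)"
proof (rule v_minus_le_v_plus)
  \<comment> \<open>The surviving part of the front with \<open>T = 1\<close> keeps every column of
    the hull nonempty.\<close>
  obtain G A where "bridged 1 G" "near_parabola 1 G A" "a < A"
    using bridged_front_exists[of 1 a] by auto
  then show "lb_dom (peeled_hull (\<lambda>x. a / 2 * x\<^sup>2 + b * x + c) m) \<noteq> {}" for m
    using above_peeled_near_parabola[of 1 G A a b c] assms by auto
qed

theorem theorem3:
  fixes a b c :: real and t :: nat
  assumes "a > 0" and "t \<ge> 1"
  defines "g \<equiv> (\<lambda>x. a / 2 * x\<^sup>2 + b * x + c)"
  shows
   "((1 / real (H t) < a \<and> (t = 1 \<or> a < 1 / real (H (t - 1))) \<and> odd t) \<longrightarrow>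
       v_minus g = ereal (1 / real t) \<and> v_plus g = ereal (1 / real t))
  \<and> ((1 / real (H t) < a \<and> (t = 1 \<or> a < 1 / real (H (t - 1))) \<and> even t) \<longrightarrow>
       ereal (1 / real (t + 1)) \<le> v_minus g \<and> v_minus g \<le> v_plus g
       \<and> v_plus g \<le> ereal (1 / (real t - 1)))
  \<and> ((a = 1 / real (H t) \<and> odd t) \<longrightarrow>
       ereal (1 / real (t + 2)) \<le> v_minus g \<and> v_minus g \<le> v_plus g
       \<and> v_plus g \<le> ereal (1 / real t))
  \<and> ((a = 1 / real (H t) \<and> even t) \<longrightarrow>
       ereal (1 / real (t + 1)) \<le> v_minus g \<and> v_minus g \<le> v_plus g
       \<and> v_plus g \<le> ereal (1 / (real t - 1)))"
proof -
  note t = \<open>t \<ge> 1\<close> and a = \<open>a > 0\<close>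
  have lower: "ereal (1 / real T) \<le> v_minus g" if "1 \<le> T" "1 / real (H T) < a" for T
    unfolding g_def by (rule v_minus_parabola_ge[OF that])
  have upper: "v_plus g \<le> ereal (1 / real T)" if "1 \<le> T" "T = 1 \<or> a < 1 / real (H (T - 1))" for T
    unfolding g_def by (rule v_plus_parabola_le[OF a that])
  have mid: "v_minus g \<le> v_plus g"
    unfolding g_def by (rule v_minus_le_v_plus_parabola[OF a])
  \<comment> \<open>The two bounds meet at \<open>1 / t\<close>; the interval for even
    \<open>t\<close> follows by weakening.\<close>
  have open_case: "v_minus g = ereal (1 / real t)" "v_plus g = ereal (1 / real t)"
    if "1 / real (H t) < a" "t = 1 \<or> a < 1 / real (H (t - 1))"
    using lower[OF t that(1)] upper[OF t that(2)] mid by auto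
  \<comment> \<open>At \<open>a = 1 / H t\<close> strict monotonicity of \<open>H\<close> makes the
    lower bound available for \<open>t + 1\<close> and the upper bound for \<open>t\<close>.\<close>
  have boundary_case: "ereal (1 / real (t + 1)) \<le> v_minus g" "v_plus g \<le> ereal (1 / real t)"
    if "a = 1 / real (H t)"
  proof -
    have "1 / real (H (t + 1)) < a"
      using H_less_Suc[OF t] H_pos[OF t] that by (simp add: frac_less2)
    then show "ereal (1 / real (t + 1)) \<le> v_minus g" by (intro lower) auto
    have "a < 1 / real (H (t - 1))" if "t \<noteq> 1"
      using that H_less_Suc[of "t - 1"] H_pos[of "t - 1"] t \<open>a = 1 / real (H t)\<close> by (simp add: frac_less2)
    then show "v_plus g \<le> ereal (1 / real t)" by (intro upper) (use t in auto)
  qed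
  have weaken: "ereal (1 / real (t + 1)) \<le> ereal (1 / real t)" "ereal (1 / real (t + 2)) \<le> ereal (1 / real (t + 1))"
    using t by (simp_all add: frac_le)
  have weaken_even: "ereal (1 / real t) \<le> ereal (1 / (real t - 1))" if "even t"
  proof -
    have "t \<noteq> 1" using that by auto
    then have "1 < real t" using t by simp
    then show ?thesis by (simp add: frac_le)
  qed
  show ?thesis
    using open_case boundary_case mid weaken weaken_even order.trans by metis
qed

end
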